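(* Let $m,n\ge 2$ be integers. Then the poset associahedron $\mathscr A(P_{(m,1,n)})$ is combinatorially equivalent to the permutohedron $\Pi_{m+n}$, but the poset associahedron $\mathscr A(P_{(1,m,n)})$ is not combinatorially equivalent to the permutohedron $\Pi_{m+n}$.
   Context: For $\mathbf a=(a_1,\dots,a_k)\in\mathbb Z^k$ with all $a_i\ge1$, the complete graded poset of type $\mathbf a$ is $P_{\mathbf a}=\{x_{ij} : 1\le i\le k,\ 1\le j\le a_i\}$, with $x_{ij}\prec x_{i'j'}$ if and only if $i<i'$ (an ordinal sum of antichains). The permutohedron $\Pi_N$ is the $(N-1)$-dimensional polytope that is the convex hull of all permutations of $(1,2,\dots,N)$ in $\mathbb R^N$. Two polytopes are combinatorially equivalent if their face lattices are isomorphic. Let $P$ be a finite connected poset (its Hasse diagram is a connected graph) with at least two elements. A proper tube of $P$ is a subset $\tau \subsetneq P$ such that: $|\tau|\ge 2$; $\tau$ is convex, i.e. for all $x,z\in\tau$ and $y\in P$, $x\preceq y\preceq z$ implies $y\in\tau$; and $\tau$ is connected as an induced subgraph of the Hasse diagram of $P$. A proper tubing of $P$ is a collection $T$ of proper tubes such that (i) any two tubes $\sigma,\tau\in T$ are nested or disjoint ($\sigma\subseteq\tau$, $\tau\subseteq\sigma$, or $\sigma\cap\tau=\emptyset$), and (ii) the directed graph $D_T$ with vertex set $T$, having an edge $(\sigma,\tau)$ whenever $\sigma\cap\tau=\emptyset$ and there exist $x\in\sigma$, $y\in\tau$ with $x\prec y$, is acyclic. The empty collection is a proper tubing. The poset associahedron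 $\mathscr A(P)$ is the simple polytope of dimension $|P|-2$ (unique up to combinatorial equivalence; its existence is a theorem of Galashin) whose poset of nonempty faces is isomorphic to the set of proper tubings of $P$ ordered by reverse inclusion. The face corresponding to a proper tubing $T$ has codimension $|T|$. *)

theory Defs
  imports "HOL-Analysis.Analysis"
begin

section \<open>Posets, tubes and tubings\<close>

text \<open>A poset is given by its reflexive order relation \<open>r\<close>; its ground set is \<^term>\<open>Field r\<close>.\<close>

definition strictly_below :: "'a rel \<Rightarrow> 'a \<Rightarrow> 'a \<Rightarrow> bool" where
  "strictly_below r x y \<longleftrightarrow> (x, y) \<in> r \<and> x \<noteq> y"

definition hasse_diagram :: "'a rel \<Rightarrow> 'a rel" where
  "hasse_diagram r =
     {(x, y). strictly_below r x y \<and> (\<nexists>z. strictly_below r x z \<and> strictly_below r z y)}"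

definition hasse_connected :: "'a rel \<Rightarrow> 'a set \<Rightarrow> bool" where
  "hasse_connected r S \<longleftrightarrow>
     (\<forall>x\<in>S. \<forall>y\<in>S. (x, y) \<in> ((hasse_diagram r \<union> (hasse_diagram r)\<inverse>) \<inter> S \<times> S)\<^sup>*)"

definition order_convex :: "'a rel \<Rightarrow> 'a set \<Rightarrow> bool" where
  "order_convex r S \<longleftrightarrow>
     (\<forall>x\<in>S. \<forall>z\<in>S. \<forall>y\<in>Field r. (x, y) \<in> r \<and> (y, z) \<in> r \<longrightarrow> y \<in> S)"

definition proper_tube :: "'a rel \<Rightarrow> 'a set \<Rightarrow> bool" where
  "proper_tube r \<tau> \<longleftrightarrow>
     \<tau> \<subset> Field r \<and> card \<tau> \<ge> 2 \<and> order_convex r \<tau> \<and> hasse_connected r \<tau>"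

definition tubing_digraph :: "'a rel \<Rightarrow> 'a set set \<Rightarrow> 'a set rel" where
  "tubing_digraph r T =
     {(\<sigma>, \<tau>). \<sigma> \<in> T \<and> \<tau> \<in> T \<and> \<sigma> \<inter> \<tau> = {} \<and> (\<exists>x\<in>\<sigma>. \<exists>y\<in>\<tau>. strictly_below r x y)}"

definition proper_tubing :: "'a rel \<Rightarrow> 'a set set \<Rightarrow> bool" where
  "proper_tubing r T \<longleftrightarrow>
     (\<forall>\<tau>\<in>T. proper_tube r \<tau>) \<and>
     (\<forall>\<sigma>\<in>T. \<forall>\<tau>\<in>T. \<sigma> \<subseteq> \<tau> \<or> \<tau> \<subseteq> \<sigma> \<or> \<sigma> \<inter> \<tau> = {}) \<and>
     acyclic (tubing_digraph r T)"

section \<open>Polytopes and their face lattices\<close>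

definition order_isomorphic_on ::
    "'a set \<Rightarrow> ('a \<Rightarrow> 'a \<Rightarrow> bool) \<Rightarrow> 'b set \<Rightarrow> ('b \<Rightarrow> 'b \<Rightarrow> bool) \<Rightarrow> bool" where
  "order_isomorphic_on A leA B leB \<longleftrightarrow>
     (\<exists>f. bij_betw f A B \<and> (\<forall>x\<in>A. \<forall>y\<in>A. leA x y \<longleftrightarrow> leB (f x) (f y)))"

definition combinatorially_equivalent ::
    "'a::euclidean_space set \<Rightarrow> 'b::euclidean_space set \<Rightarrow> bool" where
  "combinatorially_equivalent Q R \<longleftrightarrow>
     order_isomorphic_on {F. F face_of Q} (\<subseteq>) {F. F face_of R} (\<subseteq>)"

definition simple_polytope :: "'a::euclidean_space set \<Rightarrow> bool" where
  "simple_polytope Q \<longleftrightarrow>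
     polytope Q \<and>
     (\<forall>v. v extreme_point_of Q \<longrightarrow> int (card {F. F facet_of Q \<and> v \<in> F}) = aff_dim Q)"

text \<open>
  The permutohedron lives in \<open>\<real>\<^sup>N\<close> with \<open>N = CARD('n)\<close>; the vectors below are the
  rearrangements of \<open>(1, \<dots>, N)\<close>.
\<close>

definition permutohedron :: "(real ^ 'n) set" where
  "permutohedron =
     convex hull {\<chi> i. real (p i) | p. bij_betw p (UNIV :: 'n set) {1..CARD('n)}}"

text \<open>
  The poset associahedron is determined only up to combinatorial equivalence, so it is
  rendered as the property of being a realization of it.
\<close>

definition is_poset_associahedron :: "'p rel \<Rightarrow> 'a::euclidean_space set \<Rightarrow> bool" where
  "is_poset_associahedron r Q \<longleftrightarrow>
     simple_polytope Q \<and>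
     aff_dim Q = int (card (Field r)) - 2 \<and>
     order_isomorphic_on {F. F face_of Q \<and> F \<noteq> {}} (\<subseteq>) {T. proper_tubing r T} (\<supseteq>)"

section \<open>Complete graded posets\<close>

text \<open>The element \<open>x\<^sub>i\<^sub>j\<close> is the pair \<open>(i, j)\<close>; list indices start at 0, hence \<open>a ! (i - 1)\<close>.\<close>

definition complete_graded_elements :: "nat list \<Rightarrow> (nat \<times> nat) set" where
  "complete_graded_elements a =
     {(i, j). 1 \<le> i \<and> i \<le> length a \<and> 1 \<le> j \<and> j \<le> a ! (i - 1)}"

definition complete_graded_poset :: "nat list \<Rightarrow> (nat \<times> nat) rel" where
  "complete_graded_poset a =
     {(x, y). x \<in> complete_graded_elements a \<and> y \<in> complete_graded_elements a \<and>
              (x = y \<or> fst x < fst y)}"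

lemma Field_complete_graded_poset:
  "Field (complete_graded_poset a) = complete_graded_elements a"
  by (auto simp: complete_graded_poset_def Field_def)

lemma Partial_order_complete_graded_poset:
  "Partial_order (complete_graded_poset a)"
  unfolding Field_complete_graded_poset
  by (auto simp: complete_graded_poset_def partial_order_on_def preorder_on_def
      refl_on_def trans_def antisym_def)

lemma strictly_below_complete_graded_poset:
  "strictly_below (complete_graded_poset a) x y \<longleftrightarrow>
     x \<in> complete_graded_elements a \<and> y \<in> complete_graded_elements a \<and> fst x < fst y"
  by (auto simp: strictly_below_def complete_graded_poset_def)

end

theory Submission
  imports Defs
begin

text \<open>
  The face lattices are compared through simplicial complexes.  The nonempty faces of the
  permutohedron in \<open>\<real>\<^sup>N\<close> correspond to the chains of proper nonempty subsets of the \<open>N\<close>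
  coordinates: for every vector \<open>x\<close> of the polytope and every set \<open>S\<close> of coordinates the sum of \<open>x\<close>
  over \<open>S\<close> is at least \<open>1 + \<dots> + |S|\<close>, and the chain \<open>C\<close> gives the face on which the inequalities of
  the members of \<open>C\<close> are tight.  No other nonempty faces exist, because a face is the set where a
  linear functional is minimal, and the coefficients of the functional are a constant plus a positive
  combination of the indicators of their upper level sets, which form a chain
  (\<open>layer_decomposition\<close>, \<open>permutohedron_face_is_chain_face\<close>).

  The Hasse diagram of the poset of type \<open>(m, 1, n)\<close> is a star.  A connected set with at least two
  elements contains its centre, so tubes are determined by arbitrary proper nonempty sets of leaves,
  no two tubes are disjoint, and tubings are chains of subsets of an \<open>(m + n)\<close>-element set
  (\<open>tubings_m1n_isomorphic_chains\<close>).

  For type \<open>(1, m, n)\<close> the number of facets is again \<open>2\<^sup>m\<^sup>+\<^sup>n - 2\<close>, so a finer invariant is needed: the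
  parity of the number of facets that meet a given facet.  In the permutohedron a subset of size \<open>k\<close> is
  comparable with \<open>(2\<^sup>k - 2) + (2\<^sup>N\<^sup>-\<^sup>k - 2)\<close> other proper nonempty subsets, which is even.  The tube
  consisting of one middle and one top element is compatible with three families of tubes whose sizes
  are \<open>2\<^sup>i - 1\<close> for three positive \<open>i\<close>, hence with an odd number
  (\<open>tubing_degree_1mn\<close>, \<open>odd_tubing_degree_1mn\<close>).
\<close>

section \<open>Order isomorphisms\<close>

lemma order_isomorphic_on_sym:
  assumes "order_isomorphic_on A leA B leB"
  shows "order_isomorphic_on B leB A leA"
proof -
  obtain f where f: "bij_betw f A B" "\<forall>x\<in>A. \<forall>y\<in>A. leA x y \<longleftrightarrow> leB (f x) (f y)"
    using assms unfolding order_isomorphic_on_def by blast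
  have inv: "bij_betw (inv_into A f) B A"
    using f(1) by (rule bij_betw_inv_into)
  moreover have "\<forall>x\<in>B. \<forall>y\<in>B. leB x y \<longleftrightarrow> leA (inv_into A f x) (inv_into A f y)"
    using f(2) bij_betw_apply[OF inv] bij_betw_inv_into_right[OF f(1)] by simp
  ultimately show ?thesis
    unfolding order_isomorphic_on_def by blast
qed

lemma order_isomorphic_on_trans:
  assumes "order_isomorphic_on A leA B leB" and "order_isomorphic_on B leB C leC"
  shows "order_isomorphic_on A leA C leC"
proof -
  obtain f where f: "bij_betw f A B" "\<forall>x\<in>A. \<forall>y\<in>A. leA x y \<longleftrightarrow> leB (f x) (f y)"
    using assms unfolding order_isomorphic_on_def by blast
  obtain g where g: "bij_betw g B C" "\<forall>x\<in>B. \<forall>y\<in>B. leB x y \<longleftrightarrow> leC (g x) (g y)"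
    using assms unfolding order_isomorphic_on_def by blast
  have "bij_betw (g \<circ> f) A C"
    using f(1) g(1) by (rule bij_betw_trans)
  moreover have "\<forall>x\<in>A. \<forall>y\<in>A. leA x y \<longleftrightarrow> leC ((g \<circ> f) x) ((g \<circ> f) y)"
    using f g by (simp add: bij_betw_apply)
  ultimately show ?thesis
    unfolding order_isomorphic_on_def by blast
qed

text \<open>
  The empty face is the least element of every face lattice, so an isomorphism must fix it.
\<close>

lemma combinatorially_equivalent_iff_nonempty_faces:
  "combinatorially_equivalent Q R \<longleftrightarrow>
     order_isomorphic_on {F. F face_of Q \<and> F \<noteq> {}} (\<subseteq>) {F. F face_of R \<and> F \<noteq> {}} (\<subseteq>)"
    (is "?L \<longleftrightarrow> ?R")
proof
  assume ?L
  then obtain f where f: "bij_betw f {F. F face_of Q} {F. F face_of R}"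
      "\<forall>F\<in>{F. F face_of Q}. \<forall>G\<in>{F. F face_of Q}. F \<subseteq> G \<longleftrightarrow> f F \<subseteq> f G"
    unfolding combinatorially_equivalent_def order_isomorphic_on_def by blast
  have "{} \<in> f ` {F. F face_of Q}"
    using f(1) by (simp add: bij_betw_def)
  then obtain G where "G face_of Q" "f G = {}"
    by auto
  then have f0: "f {} = {}"
    using f(2) by (metis bot.extremum mem_Collect_eq subset_empty empty_face_of)
  have "bij_betw f ({F. F face_of Q} - {{}}) ({F. F face_of R} - {{}})"
    using f(1) f0 by (metis bij_betw_DiffI bij_betw_singletonI empty_face_of
        empty_subsetI insert_subset mem_Collect_eq)
  then have "bij_betw f {F. F face_of Q \<and> F \<noteq> {}} {F. F face_of R \<and> F \<noteq> {}}"
    by (simp add: set_diff_eq)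
  with f(2) show ?R
    unfolding order_isomorphic_on_def by blast
next
  assume ?R
  then obtain f where f: "bij_betw f {F. F face_of Q \<and> F \<noteq> {}} {F. F face_of R \<and> F \<noteq> {}}"
      "\<forall>F\<in>{F. F face_of Q \<and> F \<noteq> {}}. \<forall>G\<in>{F. F face_of Q \<and> F \<noteq> {}}. F \<subseteq> G \<longleftrightarrow> f F \<subseteq> f G"
    unfolding order_isomorphic_on_def by blast
  define g where "g = f({} := {})"
  have "bij_betw g {F. F face_of Q \<and> F \<noteq> {}} {F. F face_of R \<and> F \<noteq> {}}"
    using f(1) by (rule bij_betw_cong[THEN iffD1, rotated]) (simp add: g_def)
  moreover have "bij_betw g {{}} {{}}"
    by (simp add: g_def bij_betw_def)
  ultimately have "bij_betw g ({F. F face_of Q \<and> F \<noteq> {}} \<union> {{}}) ({F. F face_of R \<and> F \<noteq> {}} \<union> {{}})"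
    by (rule bij_betw_combine) auto
  moreover have "{F. F face_of Q \<and> F \<noteq> {}} \<union> {{}} = {F. F face_of Q}"
    and "{F. F face_of R \<and> F \<noteq> {}} \<union> {{}} = {F. F face_of R}"
    by auto
  ultimately have "bij_betw g {F. F face_of Q} {F. F face_of R}"
    by simp
  moreover have "F \<subseteq> G \<longleftrightarrow> g F \<subseteq> g G" if "F face_of Q" "G face_of Q" for F G
  proof (cases "F = {} \<or> G = {}")
    case True
    have "g F = {} \<Longrightarrow> F = {}"
      using bij_betw_apply[OF f(1), of F] that(1) by (auto simp: g_def split: if_splits)
    moreover have "g {} = {}"
      by (simp add: g_def)
    ultimately show ?thesis
      using True by (metis empty_subsetI subset_empty)
  next
    case False
    with f(2) that show ?thesis
      by (simp add: g_def)
  qed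
  ultimately show ?L
    unfolding combinatorially_equivalent_def order_isomorphic_on_def by blast
qed

text \<open>
  A simplex with \<open>k\<close> vertices lies above exactly \<open>2\<^sup>k\<close> simplices, so its size can be read off the order.
\<close>

lemma order_isomorphism_preserves_card:
  fixes K :: "'a set set" and L :: "'b set set"
  assumes f: "bij_betw f K L" "\<forall>S\<in>K. \<forall>T\<in>K. S \<supseteq> T \<longleftrightarrow> f S \<supseteq> f T"
    and K: "\<And>S T. S \<in> K \<Longrightarrow> T \<subseteq> S \<Longrightarrow> T \<in> K" "\<And>S. S \<in> K \<Longrightarrow> finite S"
    and L: "\<And>S T. S \<in> L \<Longrightarrow> T \<subseteq> S \<Longrightarrow> T \<in> L" "\<And>S. S \<in> L \<Longrightarrow> finite S"
    and S: "S \<in> K"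
  shows "card (f S) = card S"
proof -
  have "f ` Pow S = Pow (f S)"
  proof
    show "f ` Pow S \<subseteq> Pow (f S)"
      using f(2) K(1) S by blast
    show "Pow (f S) \<subseteq> f ` Pow S"
    proof
      fix T assume T: "T \<in> Pow (f S)"
      then have "T \<in> L"
        using L(1) f(1) S by (meson PowD bij_betw_apply)
      then obtain R where "R \<in> K" "T = f R"
        using f(1) by (auto simp: bij_betw_def)
      with T show "T \<in> f ` Pow S"
        using f(2) S by blast
    qed
  qed
  moreover have "inj_on f (Pow S)"
    using f(1) K(1) S by (meson Pow_iff bij_betw_def inj_on_subset subsetI)
  ultimately have "card (Pow (f S)) = card (Pow S)"
    by (metis card_image)
  moreover have "finite (f S)" "finite S"
    using S K(2) L(2) f(1) by (auto dest: bij_betw_apply)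
  ultimately show ?thesis
    by (simp add: card_Pow)
qed

text \<open>
  The order alone determines the degree of a vertex in the graph of a simplicial complex: the edges
  at \<open>v\<close> are the simplices of size 2 above \<open>{v}\<close>.  Applied to complexes of faces, the degree counts
  the facets that meet a given facet.
\<close>

lemma order_isomorphic_vertex_degree:
  fixes K :: "'a set set" and L :: "'b set set"
  assumes iso: "order_isomorphic_on K (\<supseteq>) L (\<supseteq>)"
    and K: "\<And>S T. S \<in> K \<Longrightarrow> T \<subseteq> S \<Longrightarrow> T \<in> K" "\<And>S. S \<in> K \<Longrightarrow> finite S"
    and L: "\<And>S T. S \<in> L \<Longrightarrow> T \<subseteq> S \<Longrightarrow> T \<in> L" "\<And>S. S \<in> L \<Longrightarrow> finite S"
    and v: "{v} \<in> K"
  obtains w where "{w} \<in> L" and "card {u. u \<noteq> w \<and> {w, u} \<in> L} = card {u. u \<noteq> v \<and> {v, u} \<in> K}"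
proof -
  obtain f where f: "bij_betw f K L" "\<forall>S\<in>K. \<forall>T\<in>K. S \<supseteq> T \<longleftrightarrow> f S \<supseteq> f T"
    using iso unfolding order_isomorphic_on_def by blast
  have card: "card (f S) = card S" if "S \<in> K" for S
    by (rule order_isomorphism_preserves_card[OF f K L that])
  obtain w where w: "f {v} = {w}"
    using card[OF v] by (auto simp: card_1_singleton_iff)
  have deg: "card {u. u \<noteq> x \<and> {x, u} \<in> M} = card {S \<in> M. {x} \<subseteq> S \<and> card S = 2}"
    for M :: "'c set set" and x
  proof (rule bij_betw_same_card)
    show "bij_betw (\<lambda>u. {x, u}) {u. u \<noteq> x \<and> {x, u} \<in> M} {S \<in> M. {x} \<subseteq> S \<and> card S = 2}"
      unfolding bij_betw_def
    proof
      show "inj_on (\<lambda>u. {x, u}) {u. u \<noteq> x \<and> {x, u} \<in> M}"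
        by (auto simp: inj_on_def doubleton_eq_iff)
      have "\<exists>u. u \<noteq> x \<and> S = {x, u}" if "x \<in> S" "card S = 2" for S
        using that by (auto simp: card_2_iff)
      then show "(\<lambda>u. {x, u}) ` {u. u \<noteq> x \<and> {x, u} \<in> M} = {S \<in> M. {x} \<subseteq> S \<and> card S = 2}"
        by fastforce
    qed
  qed
  have "f ` {S \<in> K. {v} \<subseteq> S \<and> card S = 2} = {S \<in> L. {w} \<subseteq> S \<and> card S = 2}"
  proof
    show "f ` {S \<in> K. {v} \<subseteq> S \<and> card S = 2} \<subseteq> {S \<in> L. {w} \<subseteq> S \<and> card S = 2}"
      using f v w card bij_betw_apply[OF f(1)] by (smt (verit, best) image_subsetI mem_Collect_eq)
    show "{S \<in> L. {w} \<subseteq> S \<and> card S = 2} \<subseteq> f ` {S \<in> K. {v} \<subseteq> S \<and> card S = 2}"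
    proof
      fix S assume S: "S \<in> {S \<in> L. {w} \<subseteq> S \<and> card S = 2}"
      then obtain R where "R \<in> K" "S = f R"
        using f(1) by (auto simp: bij_betw_def)
      with S show "S \<in> f ` {S \<in> K. {v} \<subseteq> S \<and> card S = 2}"
        using f(2) v w card by force
    qed
  qed
  moreover have "inj_on f {S \<in> K. {v} \<subseteq> S \<and> card S = 2}"
    using f(1) by (auto simp: bij_betw_def inj_on_def)
  ultimately have "bij_betw f {S \<in> K. {v} \<subseteq> S \<and> card S = 2} {S \<in> L. {w} \<subseteq> S \<and> card S = 2}"
    by (simp add: bij_betw_def)
  then have "card {S \<in> K. {v} \<subseteq> S \<and> card S = 2} = card {S \<in> L. {w} \<subseteq> S \<and> card S = 2}"
    by (rule bij_betw_same_card)
  then have "card {u. u \<noteq> w \<and> {w, u} \<in> L} = card {u. u \<noteq> v \<and> {v, u} \<in> K}"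
    by (simp only: deg)
  moreover have "{w} \<in> L"
    using bij_betw_apply[OF f(1) v] w by simp
  ultimately show ?thesis
    using that by blast
qed

section \<open>Chains of proper nonempty subsets\<close>

text \<open>
  The differences of successive members of a chain, from the empty set up to the whole type, are the
  blocks of an ordered set partition; this is the more usual labelling of the faces of the permutohedron.
\<close>

definition proper_subset_chains :: "'a set set set" where
  "proper_subset_chains =
     {C. (\<forall>S\<in>C. S \<noteq> {} \<and> S \<noteq> UNIV) \<and> (\<forall>S\<in>C. \<forall>T\<in>C. S \<subseteq> T \<or> T \<subseteq> S)}"

lemma proper_subset_chains_subset:
  assumes "C \<in> proper_subset_chains" "D \<subseteq> C"
  shows "D \<in> proper_subset_chains"
proof -
  have "S \<in> C" if "S \<in> D" for S
    using assms(2) that ..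
  then show ?thesis
    using assms(1) unfolding proper_subset_chains_def by simp
qed

lemma odd_card_Pow_Diff_singleton:
  assumes "finite A" "A \<noteq> {}" "B \<subseteq> A"
  shows "odd (card (Pow A - {B}))"
proof -
  have "even (card (Pow A))" 
    using assms by (simp add: card_Pow card_gt_0_iff)
  moreover have "card (Pow A) = Suc (card (Pow A - {B}))"
    using assms by (metis PowI card_Suc_Diff1 finite_Pow_iff)
  ultimately show ?thesis by simp
qed

lemma odd_card_image_Un:
  assumes "finite B" "B \<noteq> {}" "C \<subseteq> B" "A \<inter> B = {}"
  shows "odd (card ((\<union>) A ` (Pow B - {C})))"
proof -
  have "inj_on ((\<union>) A) (Pow B - {C})"
    using assms(4) by (intro inj_onI) blast
  then have "card ((\<union>) A ` (Pow B - {C})) = card (Pow B - {C})"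
    by (rule card_image)
  with odd_card_Pow_Diff_singleton[OF assms(1-3)] show ?thesis
    by (simp only:) simp
qed

text \<open>
  The subsets strictly between \<open>{}\<close> and \<open>S\<close>, and those strictly between \<open>S\<close> and the whole type, are
  each obtained from a power set by removing its two extreme members.
\<close>

lemma even_card_chain_degree:
  fixes S :: "'n::finite set"
  assumes "{S} \<in> proper_subset_chains"
  shows "even (card {T. T \<noteq> S \<and> {S, T} \<in> proper_subset_chains})"
proof -
  let ?A = "Pow S - {{}} - {S}" and ?B = "(\<union>) S ` (Pow (- S) - {{}} - {- S})"
  have S: "S \<noteq> {}" "S \<noteq> UNIV"
    using assms by (auto simp: proper_subset_chains_def)
  have "T \<in> ?B" if "S \<subseteq> T" "T \<noteq> S" "T \<noteq> UNIV" for T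
    using that by (intro image_eqI[of _ _ "T - S"]) auto
  then have link: "{T. T \<noteq> S \<and> {S, T} \<in> proper_subset_chains} = ?A \<union> ?B"
    using S by (auto simp: proper_subset_chains_def)
  have card_link: "card (?A \<union> ?B) = card ?A + card ?B"
    by (rule card_Un_disjoint) auto
  have card_above: "card ?B = card (Pow (- S) - {{}} - {- S})"
    by (rule card_image) (auto simp: inj_on_def)
  have even: "even (card (Pow X - {{}} - {X}))" if "X \<noteq> {}" for X :: "'n set"
  proof -
    have "card (Pow X - {{}}) = Suc (card (Pow X - {{}} - {X}))"
      using that by (intro card.remove) auto
    moreover have "odd (card (Pow X - {{}}))"
      using that by (intro odd_card_Pow_Diff_singleton) auto
    ultimately show ?thesis
      by (metis even_Suc)
  qed
  have "- S \<noteq> {}"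
    using S by auto
  then show ?thesis
    using even[OF S(1)] even[of "- S"] by (simp only: link card_link card_above even_add) simp
qed

section \<open>Faces of the permutohedron\<close>

lemma sum_initial_segment_le:
  fixes A :: "nat set"
  assumes "finite A" "0 \<notin> A"
  shows "\<Sum>{1..card A} \<le> \<Sum>A \<and> (\<Sum>A = \<Sum>{1..card A} \<longrightarrow> A = {1..card A})"
  using assms
proof (induction A rule: finite_linorder_max_induct)
  case empty
  then show ?case by simp
next
  case (insert b A)
  have "b \<notin> A" using insert by blast
  have "A \<subseteq> {1..<b}"
    using insert by (auto simp: Suc_le_eq intro: gr0I)
  then have "card A \<le> card {1..<b}"
    by (intro card_mono) auto
  then have b: "card A < b"
    using insert.prems by auto
  with insert \<open>b \<notin> A\<close> show ?case
    by (auto simp: atLeastAtMostSuc_conv)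
qed

definition permutation_vector :: "('n::finite \<Rightarrow> nat) \<Rightarrow> real ^ 'n" where
  "permutation_vector p = (\<chi> i. real (p i))"

lemma permutation_vector_in_permutohedron:
  fixes p :: "'n::finite \<Rightarrow> nat"
  assumes "bij_betw p UNIV {1..CARD('n)}"
  shows "permutation_vector p \<in> permutohedron"
  using assms unfolding permutohedron_def permutation_vector_def by (intro hull_inc) auto

lemma permutohedron_subset_convexI:
  fixes H :: "(real ^ 'n::finite) set"
  assumes "convex H"
    and "\<And>p. bij_betw p (UNIV :: 'n set) {1..CARD('n)} \<Longrightarrow> permutation_vector p \<in> H"
  shows "permutohedron \<subseteq> H"
  unfolding permutohedron_def
  using assms by (intro hull_minimal) (auto simp: permutation_vector_def)

lemma permutation_vector_sum:
  assumes "inj p"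
  shows "(\<Sum>i\<in>S. permutation_vector p $ i) = real (\<Sum>(p ` S))"
proof -
  have "inj_on p S"
    using assms by (rule inj_on_subset) simp
  then show ?thesis
    by (simp add: permutation_vector_def sum.reindex)
qed

text \<open>
  The values of a numbering are distinct positive integers, so over \<open>S\<close> they add up to the least
  possible amount exactly when they are the first \<open>|S|\<close> integers.
\<close>

lemma permutation_vector_sum_ge:
  fixes p :: "'n::finite \<Rightarrow> nat"
  assumes p: "bij_betw p UNIV {1..CARD('n)}"
  shows "real (\<Sum>{1..card S}) \<le> (\<Sum>i\<in>S. permutation_vector p $ i)"
    and "(\<Sum>i\<in>S. permutation_vector p $ i) = real (\<Sum>{1..card S}) \<longleftrightarrow> p ` S = {1..card S}"
proof -
  have inj: "inj p"
    using p by (simp add: bij_betw_def)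
  have "card (p ` S) = card S"
    using inj by (intro card_image) (rule inj_on_subset, auto)
  moreover have "p ` S \<subseteq> {1..CARD('n)}"
    using p by (auto simp: bij_betw_def)
  then have "0 \<notin> p ` S"
    by auto
  ultimately have *: "\<Sum>{1..card S} \<le> \<Sum>(p ` S)"
      "\<Sum>(p ` S) = \<Sum>{1..card S} \<longrightarrow> p ` S = {1..card S}"
    using sum_initial_segment_le[of "p ` S"] by simp_all
  show "real (\<Sum>{1..card S}) \<le> (\<Sum>i\<in>S. permutation_vector p $ i)"
    unfolding permutation_vector_sum[OF inj] using *(1) by (rule of_nat_mono)
  show "(\<Sum>i\<in>S. permutation_vector p $ i) = real (\<Sum>{1..card S}) \<longleftrightarrow> p ` S = {1..card S}"
    unfolding permutation_vector_sum[OF inj] of_nat_eq_iff using *(2) by auto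
qed

lemma sum_components_eq_inner:
  "(\<Sum>i\<in>S. (x :: real ^ 'n::finite) $ i) = (\<Sum>i\<in>S. axis i 1) \<bullet> x"
  by (simp add: inner_sum_left inner_axis')

lemma permutohedron_sum_ge:
  fixes x :: "real ^ 'n::finite"
  assumes "x \<in> permutohedron"
  shows "real (\<Sum>{1..card S}) \<le> (\<Sum>i\<in>S. x $ i)"
proof -
  have "convex {x :: real ^ 'n. real (\<Sum>{1..card S}) \<le> (\<Sum>i\<in>S. x $ i)}"
    unfolding sum_components_eq_inner by (rule convex_halfspace_ge)
  then have "permutohedron \<subseteq> {x :: real ^ 'n. real (\<Sum>{1..card S}) \<le> (\<Sum>i\<in>S. x $ i)}"
    using permutation_vector_sum_ge(1) by (intro permutohedron_subset_convexI) blast+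
  with assms show ?thesis by blast
qed

lemma permutohedron_sum_UNIV:
  fixes x :: "real ^ 'n::finite"
  assumes "x \<in> permutohedron"
  shows "(\<Sum>i\<in>UNIV. x $ i) = real (\<Sum>{1..CARD('n)})"
proof -
  have "convex {x :: real ^ 'n. (\<Sum>i\<in>UNIV. x $ i) = real (\<Sum>{1..CARD('n)})}"
    unfolding sum_components_eq_inner by (rule convex_hyperplane)
  moreover have "p ` UNIV = {1..CARD('n)}"
    if "bij_betw p UNIV {1..CARD('n)}" for p :: "'n \<Rightarrow> nat"
    using that by (simp add: bij_betw_def)
  ultimately have "permutohedron \<subseteq> {x :: real ^ 'n. (\<Sum>i\<in>UNIV. x $ i) = real (\<Sum>{1..CARD('n)})}"
    using permutation_vector_sum_ge(2) by (intro permutohedron_subset_convexI) blast+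
  with assms show ?thesis by blast
qed

definition chain_face :: "'n::finite set set \<Rightarrow> (real ^ 'n) set" where
  "chain_face C = {x \<in> permutohedron. \<forall>S\<in>C. (\<Sum>i\<in>S. x $ i) = real (\<Sum>{1..card S})}"

lemma chain_face_face_of: "chain_face C face_of permutohedron"
proof -
  have conv: "convex permutohedron"
    unfolding permutohedron_def by simp
  have one: "permutohedron \<inter> {x. (\<Sum>i\<in>S. axis i 1) \<bullet> x = real (\<Sum>{1..card S})} face_of permutohedron"
    for S :: "'a set"
    using conv permutohedron_sum_ge
    by (intro face_of_Int_supporting_hyperplane_ge) (auto simp: inner_sum_left inner_axis')
  have eq: "chain_face C = \<Inter> (insert permutohedron ((\<lambda>S. permutohedron \<inter>
      {x. (\<Sum>i\<in>S. axis i 1) \<bullet> x = real (\<Sum>{1..card S})}) ` C))"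
    by (auto simp: chain_face_def inner_sum_left inner_axis')
  show ?thesis
    unfolding eq using one face_of_refl[OF conv] by (intro face_of_Inter) auto
qed

text \<open>
  The chain members other than \<open>A\<close> all miss some common element (any element outside the largest of them);
  it receives the last number, and induction numbers the rest.
\<close>

lemma chain_adapted_numbering:
  assumes "finite A" "C \<subseteq> Pow A" "\<forall>S\<in>C. \<forall>T\<in>C. S \<subseteq> T \<or> T \<subseteq> S"
  shows "\<exists>p. bij_betw p A {1..card A} \<and> (\<forall>S\<in>C. p ` S = {1..card S})"
  using assms
proof (induction "card A" arbitrary: A C)
  case 0
  then have "A = {}" "C \<subseteq> {{}}" by auto
  then have "bij_betw (\<lambda>_. 0) A {1..card A} \<and> (\<forall>S\<in>C. (\<lambda>_. 0) ` S = {1..card S})"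
    by (auto simp: bij_betw_def)
  then show ?case by blast
next
  case (Suc k)
  have "\<exists>x\<in>A. \<forall>S\<in>C - {A}. x \<notin> S"
  proof (cases "C - {A} = {}")
    case True
    moreover have "A \<noteq> {}"
      using Suc.hyps by auto
    ultimately show ?thesis by blast
  next
    case False
    have "finite (C - {A})"
      using Suc.prems by (meson finite_Diff finite_Pow_iff finite_subset)
    then obtain M where M: "M \<in> C - {A}" "\<forall>S\<in>C - {A}. M \<subseteq> S \<longrightarrow> M = S"
      using False finite_has_maximal by metis
    then obtain x where "x \<in> A" "x \<notin> M"
      using Suc.prems by blast
    with M Suc.prems(3) show ?thesis by blast
  qed
  then obtain x where x: "x \<in> A" "\<forall>S\<in>C - {A}. x \<notin> S"
    by blast
  have cA: "card (A - {x}) = k"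
    using x Suc by simp
  have "\<exists>p. bij_betw p (A - {x}) {1..card (A - {x})} \<and> (\<forall>S\<in>C - {A}. p ` S = {1..card S})"
    using x Suc.prems cA by (intro Suc.hyps(1)) auto
  then obtain p where p: "bij_betw p (A - {x}) {1..k}" "\<forall>S\<in>C - {A}. p ` S = {1..card S}"
    using cA by auto
  define q where "q = p(x := Suc k)"
  have "bij_betw q (A - {x}) {1..k}"
    using p(1) by (rule bij_betw_cong[THEN iffD1, rotated]) (simp add: q_def)
  moreover have "bij_betw q {x} {Suc k}"
    by (simp add: q_def bij_betw_def)
  ultimately have "bij_betw q (A - {x} \<union> {x}) ({1..k} \<union> {Suc k})"
    by (rule bij_betw_combine) auto
  moreover have "A - {x} \<union> {x} = A" "{1..k} \<union> {Suc k} = {1..card A}"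
    using x Suc.hyps(2) by auto
  ultimately have q: "bij_betw q A {1..card A}"
    by metis
  moreover have "q ` S = {1..card S}" if "S \<in> C" for S
  proof (cases "S = A")
    case True
    then show ?thesis using q by (simp add: bij_betw_def)
  next
    case False
    with that x have "x \<notin> S" by blast
    then have "q ` S = p ` S" by (auto simp: q_def)
    with p(2) that False show ?thesis by simp
  qed
  ultimately show ?case by blast
qed

text \<open>
  This separates the faces of different chains.  If \<open>S\<close> is an initial segment of an adapted numbering,
  exchanging the numbers \<open>|S|\<close> and \<open>|S| + 1\<close> destroys this for \<open>S\<close> but keeps every initial
  segment of another size.
\<close>

lemma chain_adapted_numbering_avoiding:
  fixes S :: "'n::finite set"
  assumes C: "C \<in> proper_subset_chains" and S: "S \<noteq> {}" "S \<noteq> UNIV" "S \<notin> C"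
  obtains p where "bij_betw p UNIV {1..CARD('n)}" "\<forall>T\<in>C. p ` T = {1..card T}"
    "p ` S \<noteq> {1..card S}"
proof -
  obtain p where p: "bij_betw p (UNIV :: 'n set) {1..CARD('n)}" "\<forall>T\<in>C. p ` T = {1..card T}"
    using chain_adapted_numbering[of "UNIV :: 'n set" C] C by (auto simp: proper_subset_chains_def)
  show ?thesis
  proof (cases "p ` S = {1..card S}")
    case False
    with p that show ?thesis by blast
  next
    case True
    define k where "k = card S"
    have k: "1 \<le> k" "k < CARD('n)"
      using S psubset_card_mono[of UNIV S] by (auto simp: k_def Suc_le_eq card_gt_0_iff)
    define q where "q = Transposition.transpose k (Suc k) \<circ> p"
    have "Transposition.transpose k (Suc k) ` {1..CARD('n)} = {1..CARD('n)}"
      using k by (intro transpose_image_eq) simp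
    then have "bij_betw (Transposition.transpose k (Suc k)) {1..CARD('n)} {1..CARD('n)}"
      by (simp add: bij_betw_def inj_on_transpose)
    with p(1) have q_bij: "bij_betw q UNIV {1..CARD('n)}"
      unfolding q_def by (rule bij_betw_trans)
    have q_C: "q ` T = {1..card T}" if "T \<in> C" for T
    proof -
      have "card T \<noteq> k"
        using that p True S(3) unfolding k_def bij_betw_def
        by (metis inj_image_eq_iff)
      then have "k \<in> {1..card T} \<longleftrightarrow> Suc k \<in> {1..card T}"
        using k by auto
      then have "Transposition.transpose k (Suc k) ` {1..card T} = {1..card T}"
        by (rule transpose_image_eq)
      with p(2) that show ?thesis
        by (metis q_def image_comp)
    qed
    have "Suc k \<in> q ` S"
    proof -
      have "k \<in> p ` S" using True k by (auto simp: k_def)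
      then show ?thesis by (force simp: q_def)
    qed
    moreover have "Suc k \<notin> {1..card S}"
      by (simp add: k_def)
    ultimately have "q ` S \<noteq> {1..card S}"
      by blast
    with q_bij q_C that show ?thesis by blast
  qed
qed

lemma permutation_vector_in_chain_face_iff:
  fixes p :: "'n::finite \<Rightarrow> nat"
  assumes "bij_betw p UNIV {1..CARD('n)}"
  shows "permutation_vector p \<in> chain_face C \<longleftrightarrow> (\<forall>S\<in>C. p ` S = {1..card S})"
  using permutation_vector_in_permutohedron[OF assms]
  by (simp only: chain_face_def mem_Collect_eq permutation_vector_sum_ge(2)[OF assms] simp_thms)

lemma chain_face_nonempty:
  fixes C :: "'n::finite set set"
  assumes "C \<in> proper_subset_chains"
  shows "chain_face C \<noteq> {}"
proof -
  obtain p where p: "bij_betw p (UNIV :: 'n set) {1..CARD('n)}" "\<forall>T\<in>C. p ` T = {1..card T}"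
    using chain_adapted_numbering[of "UNIV :: 'n set" C] assms by (auto simp: proper_subset_chains_def)
  then have "permutation_vector p \<in> chain_face C"
    by (simp only: permutation_vector_in_chain_face_iff)
  then show ?thesis by blast
qed

lemma chain_face_subset_iff:
  fixes C D :: "'n::finite set set"
  assumes C: "C \<in> proper_subset_chains" and D: "D \<in> proper_subset_chains"
  shows "chain_face C \<subseteq> chain_face D \<longleftrightarrow> D \<subseteq> C"
proof
  assume sub: "chain_face C \<subseteq> chain_face D"
  show "D \<subseteq> C"
  proof (rule ccontr)
    assume "\<not> D \<subseteq> C"
    then obtain S where S: "S \<in> D" "S \<notin> C" by blast
    then have "S \<noteq> {}" "S \<noteq> UNIV"
      using D by (auto simp: proper_subset_chains_def)
    then obtain p where p: "bij_betw p (UNIV :: 'n set) {1..CARD('n)}"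
        "\<forall>T\<in>C. p ` T = {1..card T}" "p ` S \<noteq> {1..card S}"
      using chain_adapted_numbering_avoiding C S(2) by metis
    then have "permutation_vector p \<in> chain_face C"
      by (simp only: permutation_vector_in_chain_face_iff)
    moreover have "permutation_vector p \<notin> chain_face D"
      using S(1) p(3) permutation_vector_in_chain_face_iff[OF p(1)] by blast
    ultimately show False
      using sub by blast
  qed
qed (auto simp: chain_face_def)

text \<open>
  The layer-cake representation of a function with finitely many values.  The top level set carries as
  weight the distance to the second largest value; truncating the function at that value removes the
  layer, and induction on the number of values handles the rest.
\<close>

lemma layer_decomposition:
  fixes a :: "'n::finite \<Rightarrow> real"
  obtains C w c where "C \<in> proper_subset_chains" "\<forall>S\<in>C. w S > 0"
    "\<And>i. a i = c + (\<Sum>S\<in>C. w S * indicator S i)"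
proof -
  \<comment> \<open>Recording that all sets are upper level sets of \<open>a\<close> makes the chain property automatic.\<close>
  have "\<exists>C w c. (\<forall>S\<in>C. S \<noteq> {} \<and> S \<noteq> UNIV \<and> (\<exists>v. S = {i. v \<le> a i})) \<and> (\<forall>S\<in>C. w S > 0) \<and>
      (\<forall>i. a i = c + (\<Sum>S\<in>C. w S * indicator S i))"
  proof (induction "card (range a)" arbitrary: a rule: less_induct)
    case less
    define M where "M = Max (range a)"
    have le_M: "a i \<le> M" for i
      by (simp add: M_def)
    have "M \<in> range a" unfolding M_def by (rule Max_in) auto
    show ?case
    proof (cases "range a = {M}")
      case True
      then have "\<forall>i. a i = M" by auto
      then show ?thesis by (intro exI[of _ "{}"] exI[of _ "\<lambda>_. 1"] exI[of _ M]) auto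
    next
      case False
      define M' where "M' = Max (range a - {M})"
      have ne: "range a - {M} \<noteq> {}"
        using False \<open>M \<in> range a\<close> by blast
      have M'_in: "M' \<in> range a - {M}"
        unfolding M'_def using ne by (intro Max_in) auto
      have le_M': "a i \<le> M'" if "a i \<noteq> M" for i
        unfolding M'_def using that by (intro Max_ge) auto
      have M'M: "M' < M"
        using M'_in le_M by (metis DiffE imageE insertI1 order_less_le)
      define U where "U = {i. M \<le> a i}"
      define b where "b = (\<lambda>i. min (a i) M')"
      have a_eq: "a i = b i + (M - M') * indicator U i" for i
        using le_M[of i] le_M'[of i] M'M by (auto simp: b_def U_def indicator_def min_def)
      have "range b \<subseteq> range a - {M}"
        using le_M' M'_in M'M by (auto simp: b_def min_def)
      then have "range b \<subset> range a"
        using \<open>M \<in> range a\<close> by blast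
      then have "card (range b) < card (range a)"
        by (simp add: psubset_card_mono)
      from less[OF this] obtain C w c where C:
        "\<forall>S\<in>C. S \<noteq> {} \<and> S \<noteq> UNIV \<and> (\<exists>v. S = {i. v \<le> b i})" "\<forall>S\<in>C. w S > 0"
        "\<forall>i. b i = c + (\<Sum>S\<in>C. w S * indicator S i)"
        by blast
      have lev: "{i. v \<le> b i} = {i. v \<le> a i}" if "{i. v \<le> b i} \<noteq> {}" for v
        using that by (auto simp: b_def)
      have "U \<notin> C"
      proof
        assume "U \<in> C"
        then obtain v where v: "U = {i. v \<le> b i}" "U \<noteq> {}" using C(1) by metis
        then have "v \<le> M'" by (auto simp: b_def)
        obtain j where "a j = M'" using M'_in by auto
        then have "j \<in> U" using v \<open>v \<le> M'\<close> by (simp add: b_def)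
        with \<open>a j = M'\<close> M'M show False by (simp add: U_def)
      qed
      show ?thesis
      proof (intro exI[of _ "insert U C"] exI[of _ "w(U := M - M')"] exI[of _ c] conjI)
        have "U \<noteq> {}" using \<open>M \<in> range a\<close> by (auto simp: U_def)
        moreover have "U \<noteq> UNIV" using M'_in M'M unfolding U_def by (metis (mono_tags, lifting) DiffE imageE iso_tuple_UNIV_I linorder_not_less mem_Collect_eq)
        ultimately show "\<forall>S\<in>insert U C. S \<noteq> {} \<and> S \<noteq> UNIV \<and> (\<exists>v. S = {i. v \<le> a i})"
          using C(1) lev U_def by (metis insert_iff)
        show "\<forall>S\<in>insert U C. (w(U := M - M')) S > 0"
          using C(2) M'M by simp
        have "(\<Sum>S\<in>C. (w(U := M - M')) S * indicator S i) = (\<Sum>S\<in>C. w S * indicator S i)" for i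
          using \<open>U \<notin> C\<close> by (intro sum.cong) auto
        then have "(\<Sum>S\<in>insert U C. (w(U := M - M')) S * indicator S i) =
            (M - M') * indicator U i + (\<Sum>S\<in>C. w S * indicator S i)" for i
          using \<open>U \<notin> C\<close> by (subst sum.insert) (simp_all only: finite fun_upd_same simp_thms)
        then show "\<forall>i. a i = c + (\<Sum>S\<in>insert U C. (w(U := M - M')) S * indicator S i)"
          using C(3) a_eq by (simp only:) simp
      qed
    qed
  qed
  then obtain C w c where C: "\<forall>S\<in>C. S \<noteq> {} \<and> S \<noteq> UNIV \<and> (\<exists>v. S = {i. v \<le> a i})"
    "\<forall>S\<in>C. w S > 0" "\<forall>i. a i = c + (\<Sum>S\<in>C. w S * indicator S i)"
    by blast
  have "S \<subseteq> T \<or> T \<subseteq> S" if ST: "S \<in> C" "T \<in> C" for S T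
  proof -
    obtain u v where "S = {i. u \<le> a i}" "T = {i. v \<le> a i}"
      using C(1) ST by metis
    then show ?thesis
      by (cases "u \<le> v") auto
  qed
  then have "C \<in> proper_subset_chains"
    using C(1) by (auto simp: proper_subset_chains_def)
  then show ?thesis
    by (rule that[OF _ C(2) C(3)[rule_format]])
qed

text \<open>
  A face is the set of minimizers of a linear functional.  In terms of its layers the functional exceeds
  a constant by a positive combination of the slacks in the inequalities of the chain.  All slacks
  vanish somewhere on the polytope, so the minimum is attained exactly where they all vanish.
\<close>

lemma permutohedron_face_is_chain_face:
  fixes F :: "(real ^ 'n::finite) set"
  assumes F: "F face_of permutohedron" "F \<noteq> {}"
  obtains C where "C \<in> proper_subset_chains" "F = chain_face C"
proof -
  have "finite {p. bij_betw p (UNIV :: 'n set) {1..CARD('n)}}"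
    by (rule finite_subset[of _ "UNIV \<rightarrow>\<^sub>E {1..CARD('n)}"])
      (auto simp: bij_betw_def intro!: finite_PiE)
  then have "finite ((\<lambda>p. \<chi> i. real (p i)) ` {p. bij_betw p (UNIV :: 'n set) {1..CARD('n)}} :: (real ^ 'n) set)"
    by (rule finite_imageI)
  then have "polytope (permutohedron :: (real ^ 'n) set)"
    unfolding permutohedron_def polytope_def by (auto simp: setcompr_eq_image)
  then have "F exposed_face_of permutohedron"
    using F(1) by (simp add: exposed_face_of_polyhedron polytope_imp_polyhedron)
  then obtain a b where ab: "permutohedron \<subseteq> {x. a \<bullet> x \<le> b}" "F = permutohedron \<inter> {x. a \<bullet> x = b}"
    unfolding exposed_face_of_def by blast
  obtain C w c where C: "C \<in> proper_subset_chains" "\<forall>S\<in>C. w S > 0"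
      "\<And>i. - (a $ i) = c + (\<Sum>S\<in>C. w S * indicator S i)"
    using layer_decomposition[of "\<lambda>i. - (a $ i)"] by metis
  \<comment> \<open>The value of \<open>-a\<close> at a point where every inequality of the chain is tight.\<close>
  define B where "B = c * real (\<Sum>{1..CARD('n)}) + (\<Sum>S\<in>C. w S * real (\<Sum>{1..card S}))"
  have gap: "- (a \<bullet> x) - B = (\<Sum>S\<in>C. w S * ((\<Sum>i\<in>S. x $ i) - real (\<Sum>{1..card S})))"
    if "x \<in> permutohedron" for x
  proof -
    have restrict: "(\<Sum>i\<in>UNIV. indicator S i * x $ i) = (\<Sum>i\<in>S. x $ i)" for S
      by (rule sum.mono_neutral_cong_right) (auto simp: indicator_def)
    have "- (a \<bullet> x) = (\<Sum>i\<in>UNIV. - (a $ i) * x $ i)"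
      by (simp add: inner_vec_def sum_negf)
    also have "\<dots> = (\<Sum>i\<in>UNIV. c * x $ i + (\<Sum>S\<in>C. w S * (indicator S i * x $ i)))"
      by (simp only: C(3) distrib_right sum_distrib_right mult.assoc)
    also have "\<dots> = c * (\<Sum>i\<in>UNIV. x $ i) + (\<Sum>i\<in>UNIV. \<Sum>S\<in>C. w S * (indicator S i * x $ i))"
      by (simp add: sum.distrib sum_distrib_left)
    also have "(\<Sum>i\<in>UNIV. \<Sum>S\<in>C. w S * (indicator S i * x $ i)) =
        (\<Sum>S\<in>C. w S * (\<Sum>i\<in>UNIV. indicator S i * x $ i))"
      by (subst sum.swap) (simp only: sum_distrib_left)
    also have "\<dots> = (\<Sum>S\<in>C. w S * (\<Sum>i\<in>S. x $ i))"
      by (simp only: restrict)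
    finally show ?thesis
      using permutohedron_sum_UNIV[OF that]
      by (simp add: B_def right_diff_distrib sum_subtractf)
  qed
  have ge: "- (a \<bullet> x) \<ge> B" if "x \<in> permutohedron" for x
    using gap[OF that] sum_nonneg[of C "\<lambda>S. w S * ((\<Sum>i\<in>S. x $ i) - real (\<Sum>{1..card S}))"]
      C(2) permutohedron_sum_ge[OF that] by (simp add: less_imp_le)
  have eq: "- (a \<bullet> x) = B \<longleftrightarrow> x \<in> chain_face C" if "x \<in> permutohedron" for x
  proof -
    have "- (a \<bullet> x) = B \<longleftrightarrow> (\<Sum>S\<in>C. w S * ((\<Sum>i\<in>S. x $ i) - real (\<Sum>{1..card S}))) = 0"
      using gap[OF that] by linarith
    also have "\<dots> \<longleftrightarrow> (\<forall>S\<in>C. w S * ((\<Sum>i\<in>S. x $ i) - real (\<Sum>{1..card S})) = 0)"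
      using C(2) permutohedron_sum_ge[OF that]
      by (intro sum_nonneg_eq_0_iff) (auto simp: less_imp_le)
    also have "\<dots> \<longleftrightarrow> x \<in> chain_face C"
      using C(2) that by (force simp: chain_face_def)
    finally show ?thesis .
  qed
  obtain y where "y \<in> chain_face C"
    using chain_face_nonempty[OF C(1)] by blast
  then have "y \<in> permutohedron" "- (a \<bullet> y) = B"
    using eq by (auto simp: chain_face_def)
  moreover obtain x where "x \<in> permutohedron" "a \<bullet> x = b"
    using F(2) ab(2) by blast
  ultimately have "b = - B"
    using ab(1) ge[of x] by force
  then have "F = chain_face C"
    using ab(2) eq by (force simp: chain_face_def)
  with C(1) that show ?thesis by blast
qed

lemma permutohedron_faces_isomorphic_chains:
  "order_isomorphic_on (proper_subset_chains :: 'n::finite set set set) (\<supseteq>)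
     {F. F face_of (permutohedron :: (real ^ 'n) set) \<and> F \<noteq> {}} (\<subseteq>)"
proof -
  have "inj_on chain_face (proper_subset_chains :: 'n set set set)"
    by (auto intro!: inj_onI dest: chain_face_subset_iff)
  moreover have "chain_face ` (proper_subset_chains :: 'n set set set) =
      {F. F face_of permutohedron \<and> F \<noteq> {}}"
    using chain_face_face_of chain_face_nonempty permutohedron_face_is_chain_face by blast
  ultimately have "bij_betw chain_face (proper_subset_chains :: 'n set set set)
      {F. F face_of permutohedron \<and> F \<noteq> {}}"
    by (simp add: bij_betw_def)
  then show ?thesis
    unfolding order_isomorphic_on_def using chain_face_subset_iff by blast
qed

section \<open>Tubings and connected subsets of complete graded posets\<close>

lemma proper_tubing_subset:
  assumes "proper_tubing r T" "S \<subseteq> T"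
  shows "proper_tubing r S"
proof -
  have "tubing_digraph r S \<subseteq> tubing_digraph r T"
    using assms(2) by (auto simp: tubing_digraph_def)
  then show ?thesis
    using assms unfolding proper_tubing_def by (meson acyclic_subset subsetD)
qed

lemma proper_tubing_finite:
  assumes "proper_tubing r T" "finite (Field r)"
  shows "finite T"
proof (rule finite_subset)
  show "T \<subseteq> Pow (Field r)"
    using assms(1) by (auto simp: proper_tubing_def proper_tube_def)
qed (simp add: assms(2))

lemma finite_complete_graded_elements: "finite (complete_graded_elements a)"
proof -
  have "complete_graded_elements a = (SIGMA i:{1..length a}. {1..a ! (i - 1)})"
    by (auto simp: complete_graded_elements_def)
  then show ?thesis by simp
qed

text \<open>
  Nonempty levels matter here: an empty level would create covering relations that skip it.
\<close>

lemma hasse_diagram_complete_graded_poset: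
  assumes "0 \<notin> set a"
  shows "hasse_diagram (complete_graded_poset a) =
    {(x, y). x \<in> complete_graded_elements a \<and> y \<in> complete_graded_elements a \<and> fst y = Suc (fst x)}"
proof -
  let ?E = "complete_graded_elements a"
  have between: "(Suc (fst x), 1) \<in> ?E"
    if "x \<in> complete_graded_elements a" "y \<in> complete_graded_elements a" "fst x < fst y" for x y
  proof -
    have "fst x < length a"
      using that by (auto simp: complete_graded_elements_def)
    then have "a ! fst x \<noteq> 0"
      using assms by (metis nth_mem)
    with \<open>fst x < length a\<close> show ?thesis
      by (simp add: complete_graded_elements_def)
  qed
  have "(x, y) \<in> hasse_diagram (complete_graded_poset a) \<longleftrightarrow>
      x \<in> ?E \<and> y \<in> ?E \<and> fst y = Suc (fst x)" for x y
  proof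
    assume "(x, y) \<in> hasse_diagram (complete_graded_poset a)"
    then have xy: "x \<in> ?E" "y \<in> ?E" "fst x < fst y"
      and cover: "\<nexists>z. z \<in> ?E \<and> fst x < fst z \<and> fst z < fst y"
      by (auto simp: hasse_diagram_def strictly_below_complete_graded_poset)
    from cover between[OF xy] have "\<not> Suc (fst x) < fst y"
      by (metis fst_conv lessI)
    with xy show "x \<in> ?E \<and> y \<in> ?E \<and> fst y = Suc (fst x)"
      by simp
  next
    assume "x \<in> ?E \<and> y \<in> ?E \<and> fst y = Suc (fst x)"
    then show "(x, y) \<in> hasse_diagram (complete_graded_poset a)"
      by (auto simp: hasse_diagram_def strictly_below_complete_graded_poset)
  qed
  then show ?thesis
    by auto
qed

lemma hasse_connected_via_hub:
  assumes "c \<in> S"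
    and "\<And>x. x \<in> S \<Longrightarrow> (c, x) \<in> ((hasse_diagram r \<union> (hasse_diagram r)\<inverse>) \<inter> S \<times> S)\<^sup>*"
  shows "hasse_connected r S"
proof -
  let ?R = "((hasse_diagram r \<union> (hasse_diagram r)\<inverse>) \<inter> S \<times> S)\<^sup>*"
  have "sym ?R"
    by (intro sym_rtrancl) (auto simp: sym_def)
  then show ?thesis
    unfolding hasse_connected_def using assms(2) by (meson rtrancl_trans symD)
qed

lemma hasse_connected_neighbour:
  assumes "hasse_connected r S" "x \<in> S" "card S \<ge> 2"
  obtains z where "z \<in> S" "(x, z) \<in> hasse_diagram r \<or> (z, x) \<in> hasse_diagram r"
proof -
  have "S \<noteq> {x}"
    using assms(3) by auto
  then obtain y where y: "y \<in> S" "y \<noteq> x"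
    using assms(2) by blast
  then have "(x, y) \<in> ((hasse_diagram r \<union> (hasse_diagram r)\<inverse>) \<inter> S \<times> S)\<^sup>*"
    using assms by (simp add: hasse_connected_def)
  with y(2) show ?thesis
    using that by (auto elim: converse_rtranclE)
qed

lemma order_convex_complete_graded_poset:
  assumes "\<And>x y z. x \<in> S \<Longrightarrow> z \<in> S \<Longrightarrow> y \<in> complete_graded_elements a \<Longrightarrow> fst x < fst y \<Longrightarrow> fst y < fst z \<Longrightarrow> y \<in> S"
  shows "order_convex (complete_graded_poset a) S"
  unfolding order_convex_def Field_complete_graded_poset complete_graded_poset_def
  using assms by blast

section \<open>The poset of type (m, 1, n)\<close>

lemma complete_graded_elements_m1n:
  "complete_graded_elements [m, 1, n] = insert (2, 1) ({1} \<times> {1..m} \<union> {3} \<times> {1..n})"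
  by (force simp: complete_graded_elements_def nth_Cons' less_Suc_eq_le numeral_eq_Suc le_Suc_eq)

text \<open>
  Every edge of the Hasse diagram contains the centre \<open>(2, 1)\<close>, and every element is adjacent to it.  A
  set containing the centre is convex because only the centre lies strictly between two elements.
\<close>

lemma proper_tube_m1n_iff:
  assumes "m \<ge> 1" "n \<ge> 1"
  shows "proper_tube (complete_graded_poset [m, 1, n]) \<tau> \<longleftrightarrow>
    (2, 1) \<in> \<tau> \<and> \<tau> \<noteq> {(2, 1)} \<and> \<tau> \<subset> complete_graded_elements [m, 1, n]"
    (is "_ \<longleftrightarrow> ?c \<in> \<tau> \<and> _ \<and> _ \<subset> ?E")
proof
  have hasse: "hasse_diagram (complete_graded_poset [m, 1, n]) =
      {(x, y). x \<in> ?E \<and> y \<in> ?E \<and> fst y = Suc (fst x)}"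
    using assms by (intro hasse_diagram_complete_graded_poset) auto
  have level: "x = ?c \<longleftrightarrow> fst x = 2" "fst x = 1 \<or> fst x = 2 \<or> fst x = 3" if "x \<in> ?E" for x
    using that unfolding complete_graded_elements_m1n by auto
  {
    assume "proper_tube (complete_graded_poset [m, 1, n]) \<tau>"
    then have \<tau>: "\<tau> \<subset> ?E" "card \<tau> \<ge> 2" "hasse_connected (complete_graded_poset [m, 1, n]) \<tau>"
      by (auto simp: proper_tube_def Field_complete_graded_poset)
    then obtain x where "x \<in> \<tau>" by fastforce
    obtain z where "z \<in> \<tau>" and "(x, z) \<in> hasse_diagram (complete_graded_poset [m, 1, n]) \<or>
        (z, x) \<in> hasse_diagram (complete_graded_poset [m, 1, n])"
      by (rule hasse_connected_neighbour[OF \<tau>(3) \<open>x \<in> \<tau>\<close> \<tau>(2)])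
    then have "fst z = Suc (fst x) \<or> fst x = Suc (fst z)"
      unfolding hasse by auto
    moreover have "x \<in> ?E" "z \<in> ?E"
      using \<tau>(1) \<open>x \<in> \<tau>\<close> \<open>z \<in> \<tau>\<close> by blast+
    ultimately have "x = ?c \<or> z = ?c"
      using level[of x] level[of z] by auto
    then have "?c \<in> \<tau>"
      using \<open>x \<in> \<tau>\<close> \<open>z \<in> \<tau>\<close> by blast
    with \<tau> show "?c \<in> \<tau> \<and> \<tau> \<noteq> {?c} \<and> \<tau> \<subset> ?E"
      by auto
  }
  assume \<tau>: "?c \<in> \<tau> \<and> \<tau> \<noteq> {?c} \<and> \<tau> \<subset> ?E"
  then have "finite \<tau>"
    using finite_complete_graded_elements by (meson finite_subset psubset_imp_subset)
  moreover obtain x where "x \<in> \<tau>" "x \<noteq> ?c"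
    using \<tau> by blast
  ultimately have "card {?c, x} \<le> card \<tau>"
    using \<tau> by (intro card_mono) auto
  with \<open>x \<noteq> ?c\<close> have "card \<tau> \<ge> 2" by simp
  moreover have "order_convex (complete_graded_poset [m, 1, n]) \<tau>"
  proof (rule order_convex_complete_graded_poset)
    fix x y z assume "x \<in> \<tau>" "z \<in> \<tau>" and y: "y \<in> ?E" "fst x < fst y" "fst y < fst z"
    then have "x \<in> ?E" "z \<in> ?E"
      using \<tau> by blast+
    then have "y = ?c"
      using y level[of x] level[of y] level[of z] by auto
    with \<tau> show "y \<in> \<tau>" by blast
  qed
  moreover have "hasse_connected (complete_graded_poset [m, 1, n]) \<tau>"
  proof (rule hasse_connected_via_hub)
    show "?c \<in> \<tau>" using \<tau> by blast
    fix x assume "x \<in> \<tau>"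
    then have "x \<in> ?E" "?c \<in> ?E"
      using \<tau> by blast+
    show "(?c, x) \<in> ((hasse_diagram (complete_graded_poset [m, 1, n]) \<union>
        (hasse_diagram (complete_graded_poset [m, 1, n]))\<inverse>) \<inter> \<tau> \<times> \<tau>)\<^sup>*"
    proof (cases "x = ?c")
      case False
      then have "fst x = 1 \<or> fst x = 3"
        using level[of x] \<open>x \<in> ?E\<close> by blast
      then have "fst x = Suc 2 \<or> 2 = Suc (fst x)"
        by auto
      then show ?thesis
        unfolding hasse using \<tau> \<open>x \<in> \<tau>\<close> \<open>x \<in> ?E\<close> \<open>?c \<in> ?E\<close> by (intro r_into_rtrancl) simp
    qed simp
  qed
  ultimately show "proper_tube (complete_graded_poset [m, 1, n]) \<tau>"
    using \<tau> by (simp add: proper_tube_def Field_complete_graded_poset)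
qed

lemma proper_tubing_m1n_iff:
  assumes "m \<ge> 1" "n \<ge> 1"
  shows "proper_tubing (complete_graded_poset [m, 1, n]) T \<longleftrightarrow>
    (\<forall>\<tau>\<in>T. proper_tube (complete_graded_poset [m, 1, n]) \<tau>) \<and> (\<forall>\<sigma>\<in>T. \<forall>\<tau>\<in>T. \<sigma> \<subseteq> \<tau> \<or> \<tau> \<subseteq> \<sigma>)"
proof -
  let ?r = "complete_graded_poset [m, 1, n]"
  have "proper_tubing ?r T \<longleftrightarrow> (\<forall>\<sigma>\<in>T. \<forall>\<tau>\<in>T. \<sigma> \<subseteq> \<tau> \<or> \<tau> \<subseteq> \<sigma>)"
    if tubes: "\<forall>\<tau>\<in>T. proper_tube ?r \<tau>"
  proof -
    have meet: "\<sigma> \<inter> \<tau> \<noteq> {}" if "\<sigma> \<in> T" "\<tau> \<in> T" for \<sigma> \<tau>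
      using that tubes unfolding proper_tube_m1n_iff[OF assms] by blast
    then have "tubing_digraph ?r T = {}"
      unfolding tubing_digraph_def by blast
    then have "acyclic (tubing_digraph ?r T)"
      by (simp add: acyclic_def)
    moreover have "(\<forall>\<sigma>\<in>T. \<forall>\<tau>\<in>T. \<sigma> \<subseteq> \<tau> \<or> \<tau> \<subseteq> \<sigma> \<or> \<sigma> \<inter> \<tau> = {}) \<longleftrightarrow>
        (\<forall>\<sigma>\<in>T. \<forall>\<tau>\<in>T. \<sigma> \<subseteq> \<tau> \<or> \<tau> \<subseteq> \<sigma>)"
      using meet by (intro ball_cong refl) simp
    ultimately show ?thesis
      unfolding proper_tubing_def using tubes by argo
  qed
  moreover have "\<forall>\<tau>\<in>T. proper_tube ?r \<tau>" if "proper_tubing ?r T"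
    using that unfolding proper_tubing_def by (elim conjE)
  ultimately show ?thesis
    by argo
qed

lemma tubings_m1n_isomorphic_chains:
  assumes "m \<ge> 1" "n \<ge> 1" "CARD('n::finite) = m + n"
  shows "order_isomorphic_on {T. proper_tubing (complete_graded_poset [m, 1, n]) T} (\<supseteq>)
    (proper_subset_chains :: 'n set set set) (\<supseteq>)"
proof -
  define leaves :: "(nat \<times> nat) set" where "leaves = {1} \<times> {1..m} \<union> {3} \<times> {1..n}"
  define tubes where "tubes = {\<tau>. proper_tube (complete_graded_poset [m, 1, n]) \<tau>}"
  have c: "(2, 1) \<notin> leaves"
    by (auto simp: leaves_def)
  have tube_iff: "\<tau> \<in> tubes \<longleftrightarrow> (2, 1) \<in> \<tau> \<and> \<tau> \<noteq> {(2, 1)} \<and> \<tau> \<subset> insert (2, 1) leaves" for \<tau>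
    unfolding tubes_def mem_Collect_eq proper_tube_m1n_iff[OF assms(1,2)]
      complete_graded_elements_m1n leaves_def ..
  have tubes: "tubes = insert (2, 1) ` (Pow leaves - {{}, leaves})"
  proof (intro set_eqI iffI)
    fix \<tau> assume "\<tau> \<in> tubes"
    then have \<tau>: "(2, 1) \<in> \<tau>" "\<tau> \<noteq> {(2, 1)}" "\<tau> \<subset> insert (2, 1) leaves"
      unfolding tube_iff by blast+
    then have "\<tau> - {(2, 1)} \<in> Pow leaves - {{}, leaves}"
      using c by auto
    moreover have "\<tau> = insert (2, 1) (\<tau> - {(2, 1)})"
      using \<tau>(1) by blast
    ultimately show "\<tau> \<in> insert (2, 1) ` (Pow leaves - {{}, leaves})"
      by (rule rev_image_eqI)
  next
    fix \<tau> assume "\<tau> \<in> insert (2, 1) ` (Pow leaves - {{}, leaves})"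
    then obtain X where X: "\<tau> = insert (2, 1) X" "X \<subset> leaves" "X \<noteq> {}"
      by (elim imageE) auto
    then have "(2, 1) \<notin> X"
      using c by blast
    then have "\<tau> \<noteq> insert (2, 1) leaves" "\<tau> \<noteq> {(2, 1)}"
      using X c by (simp_all add: insert_ident psubset_eq) blast
    with X show "\<tau> \<in> tubes"
      unfolding tube_iff by blast
  qed
  have "card leaves = card ({1::nat} \<times> {1..m}) + card ({3::nat} \<times> {1..n})"
    unfolding leaves_def by (rule card_Un_disjoint) auto
  then have "card leaves = CARD('n)"
    using assms(3) by simp
  moreover have "finite leaves"
    by (simp add: leaves_def)
  ultimately obtain e :: "nat \<times> nat \<Rightarrow> 'n" where e: "bij_betw e leaves UNIV"
    using finite_same_card_bij[of leaves "UNIV :: 'n set"] by auto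
  define g where "g = (\<lambda>\<tau>. e ` (\<tau> - {(2, 1)}))"
  have g_sub: "g \<sigma> \<subseteq> g \<tau> \<longleftrightarrow> \<sigma> \<subseteq> \<tau>" if "\<sigma> \<in> tubes" "\<tau> \<in> tubes" for \<sigma> \<tau>
  proof -
    have "\<sigma> - {(2, 1)} \<subseteq> leaves" "\<tau> - {(2, 1)} \<subseteq> leaves" "(2, 1) \<in> \<sigma>" "(2, 1) \<in> \<tau>"
      using that by (auto simp: tubes)
    then show ?thesis
      using inj_on_image_subset_iff[of e leaves] e by (auto simp: g_def bij_betw_def)
  qed
  have g_tubes: "g ` tubes = {S. S \<noteq> {} \<and> S \<noteq> UNIV}"
  proof -
    have "g (insert (2, 1) S) = e ` S" if "S \<in> Pow leaves - {{}, leaves}" for S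
    proof -
      have "insert (2, 1) S - {(2, 1)} = S"
        using that c by blast
      then show ?thesis
        by (simp only: g_def)
    qed
    then have "g ` tubes = (`) e ` (Pow leaves - {{}, leaves})"
      unfolding tubes image_image by (rule image_cong[OF refl])
    also have "\<dots> = (`) e ` Pow leaves - (`) e ` {{}, leaves}"
    proof (rule inj_on_image_set_diff[where C = "Pow leaves"])
      show "inj_on ((`) e) (Pow leaves)"
        using e by (simp add: bij_betw_def inj_on_image_Pow)
    qed auto
    also have "\<dots> = {S. S \<noteq> {} \<and> S \<noteq> UNIV}"
      using e by (auto simp: bij_betw_def image_Pow_surj)
    finally show ?thesis .
  qed
  have inj: "inj_on g tubes"
  proof (rule inj_onI)
    fix \<sigma> \<tau> assume "\<sigma> \<in> tubes" "\<tau> \<in> tubes" "g \<sigma> = g \<tau>"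
    then show "\<sigma> = \<tau>"
      using g_sub[of \<sigma> \<tau>] g_sub[of \<tau> \<sigma>] by simp
  qed
  have T_iff: "proper_tubing (complete_graded_poset [m, 1, n]) T \<longleftrightarrow>
      T \<subseteq> tubes \<and> (\<forall>\<sigma>\<in>T. \<forall>\<tau>\<in>T. \<sigma> \<subseteq> \<tau> \<or> \<tau> \<subseteq> \<sigma>)" for T
    unfolding proper_tubing_m1n_iff[OF assms(1,2)] tubes_def by blast
  have sub: "g ` T \<subseteq> g ` T' \<longleftrightarrow> T \<subseteq> T'" if "T \<subseteq> tubes" "T' \<subseteq> tubes" for T T'
    using inj_on_image_subset_iff[OF inj that] .
  have "bij_betw ((`) g) {T. proper_tubing (complete_graded_poset [m, 1, n]) T} proper_subset_chains"
    unfolding bij_betw_def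
  proof
    show "inj_on ((`) g) {T. proper_tubing (complete_graded_poset [m, 1, n]) T}"
      using inj_on_image_Pow[OF inj] by (rule inj_on_subset) (unfold T_iff, blast)
    have chain: "g ` T \<in> proper_subset_chains \<longleftrightarrow> proper_tubing (complete_graded_poset [m, 1, n]) T"
      if T: "T \<subseteq> tubes" for T
    proof -
      have "(\<forall>\<sigma>\<in>T. \<forall>\<tau>\<in>T. g \<sigma> \<subseteq> g \<tau> \<or> g \<tau> \<subseteq> g \<sigma>) \<longleftrightarrow> (\<forall>\<sigma>\<in>T. \<forall>\<tau>\<in>T. \<sigma> \<subseteq> \<tau> \<or> \<tau> \<subseteq> \<sigma>)"
        using g_sub T by (meson subsetD)
      moreover have "\<forall>\<tau>\<in>T. g \<tau> \<noteq> {} \<and> g \<tau> \<noteq> UNIV"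
        using g_tubes T by blast
      ultimately show ?thesis
        unfolding T_iff using T by (simp add: proper_subset_chains_def)
    qed
    show "(`) g ` {T. proper_tubing (complete_graded_poset [m, 1, n]) T} = proper_subset_chains"
    proof (intro set_eqI iffI)
      fix C assume "C \<in> (`) g ` {T. proper_tubing (complete_graded_poset [m, 1, n]) T}"
      then show "C \<in> proper_subset_chains"
        using chain T_iff by blast
    next
      fix C :: "'n set set" assume C: "C \<in> proper_subset_chains"
      then have "C \<subseteq> g ` tubes"
        by (auto simp: g_tubes proper_subset_chains_def)
      then obtain T where "T \<subseteq> tubes" "C = g ` T"
        by (meson subset_imageE)
      then show "C \<in> (`) g ` {T. proper_tubing (complete_graded_poset [m, 1, n]) T}"
        using C chain by blast
    qed
  qed
  moreover have "T \<supseteq> T' \<longleftrightarrow> g ` T \<supseteq> g ` T'"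
    if "proper_tubing (complete_graded_poset [m, 1, n]) T" "proper_tubing (complete_graded_poset [m, 1, n]) T'" for T T'
    using that sub[of T' T] unfolding T_iff by blast
  ultimately show ?thesis
    unfolding order_isomorphic_on_def by blast
qed

section \<open>The poset of type (1, m, n)\<close>

lemma complete_graded_elements_1mn:
  "complete_graded_elements [1, m, n] = insert (1, 1) ({2} \<times> {1..m} \<union> {3} \<times> {1..n})"
  by (force simp: complete_graded_elements_def nth_Cons' less_Suc_eq_le numeral_eq_Suc le_Suc_eq)

lemma hasse_diagram_1mn:
  assumes "m \<ge> 1" "n \<ge> 1"
  shows "hasse_diagram (complete_graded_poset [1, m, n]) =
    {(x, y). x \<in> complete_graded_elements [1, m, n] \<and> y \<in> complete_graded_elements [1, m, n] \<and>
      fst y = Suc (fst x)}"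
  using assms by (intro hasse_diagram_complete_graded_poset) auto

text \<open>
  A middle and a top element together are adjacent to every element of level 2 or 3, and the middle one
  also to the bottom, so connectedness is free.  Convexity can only fail between the bottom and a top
  element.
\<close>

lemma proper_tube_1mn_upper:
  assumes "m \<ge> 1" "n \<ge> 1"
    and \<tau>: "\<tau> \<subset> complete_graded_elements [1, m, n]" "(2, 1) \<in> \<tau>" "(3, 1) \<in> \<tau>"
    and mids: "(1, 1) \<in> \<tau> \<Longrightarrow> {2} \<times> {1..m} \<subseteq> \<tau>"
  shows "proper_tube (complete_graded_poset [1, m, n]) \<tau>"
proof -
  let ?r = "complete_graded_poset [1, m, n]"
  let ?R = "(hasse_diagram ?r \<union> (hasse_diagram ?r)\<inverse>) \<inter> \<tau> \<times> \<tau>"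
  have level: "x = (1, 1) \<or> x \<in> {2} \<times> {1..m} \<or> fst x = 3" if "x \<in> complete_graded_elements [1, m, n]" for x
    using that unfolding complete_graded_elements_1mn by auto
  have adj: "(x, y) \<in> ?R" if "x \<in> \<tau>" "y \<in> \<tau>" "fst y = Suc (fst x) \<or> fst x = Suc (fst y)" for x y
    using that \<tau>(1) unfolding hasse_diagram_1mn[OF assms(1,2)] by auto
  have "finite \<tau>"
    using \<tau>(1) finite_complete_graded_elements by (meson finite_subset psubset_imp_subset)
  then have "card {(2, 1), (3, 1) :: nat \<times> nat} \<le> card \<tau>"
    using \<tau> by (intro card_mono) auto
  moreover have "order_convex ?r \<tau>"
  proof (rule order_convex_complete_graded_poset)
    fix x y z
    assume *: "x \<in> \<tau>" "z \<in> \<tau>" "y \<in> complete_graded_elements [1, m, n]" "fst x < fst y" "fst y < fst z"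
    then have "x \<in> complete_graded_elements [1, m, n]" "z \<in> complete_graded_elements [1, m, n]"
      using \<tau>(1) by blast+
    then have "x = (1, 1)" "y \<in> {2} \<times> {1..m}"
      using level[of x] level[of y] level[of z] *(3-5) by auto
    with mids *(1) show "y \<in> \<tau>" by blast
  qed
  moreover have "hasse_connected ?r \<tau>"
  proof (rule hasse_connected_via_hub)
    fix x assume x: "x \<in> \<tau>"
    show "((2, 1), x) \<in> ?R\<^sup>*"
    proof (cases "fst x = 2")
      case True
      then have "((2, 1), (3, 1)) \<in> ?R" "((3, 1), x) \<in> ?R"
        using x \<tau> by (intro adj; simp)+
      then show ?thesis by (meson converse_rtrancl_into_rtrancl r_into_rtrancl)
    next
      case False
      then have "fst x = 1 \<or> fst x = 3"
        using level[OF subsetD[OF psubset_imp_subset[OF \<tau>(1)] x]] by auto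
      then show ?thesis
        using x \<tau>(2) by (intro r_into_rtrancl adj) auto
    qed
  qed (fact \<tau>(2))
  ultimately show ?thesis
    using \<tau>(1) by (simp add: proper_tube_def Field_complete_graded_poset)
qed

lemma proper_tube_1mn_lower:
  assumes "m \<ge> 1" "n \<ge> 1" and X: "X \<subseteq> {2} \<times> {1..m}" "X \<noteq> {}"
  shows "proper_tube (complete_graded_poset [1, m, n]) (insert (1, 1) X)"
proof -
  let ?r = "complete_graded_poset [1, m, n]" and ?\<tau> = "insert (1, 1) X"
  have sub: "?\<tau> \<subset> complete_graded_elements [1, m, n]"
  proof
    show "?\<tau> \<subseteq> complete_graded_elements [1, m, n]"
      using X unfolding complete_graded_elements_1mn by auto
    have "(3, 1) \<in> complete_graded_elements [1, m, n]" "(3, 1) \<notin> ?\<tau>"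
      using assms unfolding complete_graded_elements_1mn by auto
    then show "?\<tau> \<noteq> complete_graded_elements [1, m, n]" by metis
  qed
  have "finite X"
    using X(1) by (rule finite_subset) simp
  moreover have "(1, 1) \<notin> X"
    using X(1) by auto
  ultimately have "card ?\<tau> = Suc (card X)" "card X \<noteq> 0"
    using X(2) by auto
  then have "card ?\<tau> \<ge> 2" by simp
  moreover have "order_convex ?r ?\<tau>"
  proof (rule order_convex_complete_graded_poset)
    fix x y z :: "nat \<times> nat"
    assume "x \<in> ?\<tau>" "z \<in> ?\<tau>" "fst x < fst y" "fst y < fst z"
    moreover have "fst u = 1 \<or> fst u = 2" if "u \<in> ?\<tau>" for u
      using that X(1) by auto
    ultimately have False
      by (metis less_trans less_irrefl not_less_eq one_add_one plus_1_eq_Suc)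
    then show "y \<in> ?\<tau>" ..
  qed
  moreover have "hasse_connected ?r ?\<tau>"
  proof (rule hasse_connected_via_hub)
    fix x assume x: "x \<in> ?\<tau>"
    show "((1, 1), x) \<in> ((hasse_diagram ?r \<union> (hasse_diagram ?r)\<inverse>) \<inter> ?\<tau> \<times> ?\<tau>)\<^sup>*"
    proof (cases "x = (1, 1)")
      case False
      with x X(1) have "fst x = Suc 1"
        by auto
      moreover have "x \<in> complete_graded_elements [1, m, n]" "(1, 1) \<in> complete_graded_elements [1, m, n]"
        using x sub by blast+
      ultimately show ?thesis
        unfolding hasse_diagram_1mn[OF assms(1,2)] using x by (intro r_into_rtrancl) auto
    qed simp
  qed simp
  ultimately show ?thesis
    using sub by (simp add: proper_tube_def Field_complete_graded_poset)
qed

text \<open>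
  The tubes compatible with \<open>\<tau>\<close> fall into those containing \<open>\<tau>\<close> but not the bottom, those containing \<open>\<tau>\<close>
  and the bottom (and then, by convexity, the whole middle level), and those disjoint from \<open>\<tau>\<close>.  A
  disjoint tube with a top element contains no bottom by convexity, hence contains a middle element by
  connectedness; then it has elements both above and below elements of \<open>\<tau>\<close>, which is a directed cycle
  of length 2.  So a disjoint tube consists of the bottom and middle elements.
\<close>

lemma tubing_degree_1mn:
  assumes "m \<ge> 1" "n \<ge> 1"
  defines "\<tau> \<equiv> {(2, 1), (3, 1)}"
  defines "M \<equiv> {2} \<times> {1..m}" and "N \<equiv> {3} \<times> {1..n}"
  shows "{\<sigma>. \<sigma> \<noteq> \<tau> \<and> proper_tubing (complete_graded_poset [1, m, n]) {\<tau>, \<sigma>}} =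
    (\<union>) \<tau> ` (Pow (M \<union> N - \<tau>) - {{}}) \<union>
    (\<union>) (insert (1, 1) (M \<union> {(3, 1)})) ` (Pow (N - {(3, 1)}) - {N - {(3, 1)}}) \<union>
    (\<union>) {(1, 1)} ` (Pow (M - {(2, 1)}) - {{}})"
    (is "?L = ?K1 \<union> ?K2 \<union> ?K3")
proof
  let ?r = "complete_graded_poset [1, m, n]"
  have E: "complete_graded_elements [1, m, n] = insert (1, 1) (M \<union> N)"
    unfolding M_def N_def by (rule complete_graded_elements_1mn)
  have \<tau>_MN: "(2, 1) \<in> M" "(3, 1) \<in> N" "\<tau> \<subseteq> M \<union> N" "(1, 1) \<notin> M \<union> N" "M \<inter> N = {}"
    using assms(1,2) by (auto simp: \<tau>_def M_def N_def)
  have level: "fst x = 2 \<longleftrightarrow> x \<in> M" "fst x = 3 \<longleftrightarrow> x \<in> N" "fst x = 1 \<longleftrightarrow> x = (1, 1)" "fst x = 1 \<or> fst x = 2 \<or> fst x = 3"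
    if "x \<in> insert (1, 1) (M \<union> N)" for x
    using that by (auto simp: M_def N_def)
  have hasse: "hasse_diagram ?r = {(x, y). x \<in> insert (1, 1) (M \<union> N) \<and> y \<in> insert (1, 1) (M \<union> N) \<and> fst y = Suc (fst x)}"
    unfolding hasse_diagram_1mn[OF assms(1,2)] E ..
  have below: "strictly_below ?r x y \<longleftrightarrow> x \<in> insert (1, 1) (M \<union> N) \<and> y \<in> insert (1, 1) (M \<union> N) \<and> fst x < fst y" for x y
    unfolding strictly_below_complete_graded_poset E ..
  have upper: "proper_tube ?r \<sigma>"
    if "\<sigma> \<subset> insert (1, 1) (M \<union> N)" "\<tau> \<subseteq> \<sigma>" "(1, 1) \<in> \<sigma> \<Longrightarrow> M \<subseteq> \<sigma>" for \<sigma>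
  proof (rule proper_tube_1mn_upper[OF assms(1,2)])
    show "\<sigma> \<subset> complete_graded_elements [1, m, n]"
      unfolding E by (fact that(1))
    show "(2, 1) \<in> \<sigma>" "(3, 1) \<in> \<sigma>"
      using that(2) by (auto simp: \<tau>_def)
    show "{2} \<times> {1..m} \<subseteq> \<sigma>" if "(1, 1) \<in> \<sigma>"
      using \<open>(1, 1) \<in> \<sigma> \<Longrightarrow> M \<subseteq> \<sigma>\<close> that by (simp add: M_def)
  qed
  have tube_\<tau>: "proper_tube ?r \<tau>"
    using \<tau>_MN by (intro upper) blast+
  {
    fix \<sigma> assume "\<sigma> \<in> ?L"
    then have "\<sigma> \<noteq> \<tau>" "proper_tube ?r \<sigma>" and nested: "\<sigma> \<subseteq> \<tau> \<or> \<tau> \<subseteq> \<sigma> \<or> \<sigma> \<inter> \<tau> = {}"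
      and acyc: "acyclic (tubing_digraph ?r {\<tau>, \<sigma>})"
      by (auto simp: proper_tubing_def)
    then have \<sigma>: "\<sigma> \<subset> insert (1, 1) (M \<union> N)" "card \<sigma> \<ge> 2" "order_convex ?r \<sigma>" "hasse_connected ?r \<sigma>"
      unfolding proper_tube_def Field_complete_graded_poset E by blast+
    have convex: "y \<in> \<sigma>" if "(1, 1) \<in> \<sigma>" "y \<in> M" "z \<in> \<sigma>" "z \<in> N" for y z
    proof -
      have "y \<in> complete_graded_elements [1, m, n]" "z \<in> complete_graded_elements [1, m, n]"
          "(1, 1) \<in> complete_graded_elements [1, m, n]"
        unfolding E using that by blast+
      moreover have "fst y = 2" "fst z = 3"
        using that by (auto simp: M_def N_def)
      ultimately have "((1, 1), y) \<in> ?r" "(y, z) \<in> ?r" "y \<in> Field ?r"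
        unfolding complete_graded_poset_def Field_complete_graded_poset[unfolded complete_graded_poset_def]
        by simp_all
      with \<sigma>(3) that show ?thesis
        unfolding order_convex_def by blast
    qed
    have "\<not> \<sigma> \<subseteq> \<tau>"
    proof
      assume "\<sigma> \<subseteq> \<tau>"
      moreover have "card \<tau> = 2" "finite \<tau>"
        by (simp_all add: \<tau>_def)
      ultimately show False
        using \<sigma>(2) \<open>\<sigma> \<noteq> \<tau>\<close> card_seteq[of \<tau> \<sigma>] by simp
    qed
    then consider "\<tau> \<subseteq> \<sigma>" "(1, 1) \<notin> \<sigma>" | "\<tau> \<subseteq> \<sigma>" "(1, 1) \<in> \<sigma>" | "\<sigma> \<inter> \<tau> = {}"
      using nested by blast
    then have "\<sigma> \<in> ?K1 \<union> ?K2 \<union> ?K3"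
    proof cases
      case 1
      then have "\<sigma> \<in> ?K1"
        using \<sigma>(1) \<open>\<sigma> \<noteq> \<tau>\<close> by (intro image_eqI[of _ _ "\<sigma> - \<tau>"]) auto
      then show ?thesis by blast
    next
      case 2
      then have "(3, 1) \<in> \<sigma>" by (simp add: \<tau>_def)
      then have "M \<subseteq> \<sigma>"
        using 2 convex \<tau>_MN by blast
      then have "\<sigma> \<in> ?K2"
        using \<sigma>(1) 2(2) \<open>(3, 1) \<in> \<sigma>\<close> \<tau>_MN by (intro image_eqI[of _ _ "\<sigma> \<inter> N - {(3, 1)}"]) auto
      then show ?thesis by blast
    next
      case 3
      have "\<sigma> \<inter> N = {}"
      proof (rule ccontr)
        assume "\<sigma> \<inter> N \<noteq> {}"
        then obtain z where z: "z \<in> \<sigma>" "z \<in> N" by blast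
        have "(1, 1) \<notin> \<sigma>"
          using convex[of "(2, 1)" z] z 3 \<tau>_MN by (auto simp: \<tau>_def)
        moreover obtain x where "x \<in> \<sigma>" and "(z, x) \<in> hasse_diagram ?r \<or> (x, z) \<in> hasse_diagram ?r"
          by (rule hasse_connected_neighbour[OF \<sigma>(4) z(1) \<sigma>(2)])
        then have "x \<in> insert (1, 1) (M \<union> N)" "fst x = Suc (fst z) \<or> fst z = Suc (fst x)"
          unfolding hasse by auto
        ultimately have x: "x \<in> \<sigma>" "x \<in> M"
          using z \<open>x \<in> \<sigma>\<close> level[of z] level[of x] by auto
        \<comment> \<open>The two comparisons that close the cycle.\<close>
        have "strictly_below ?r (2, 1) z" "strictly_below ?r x (3, 1)"
          unfolding below using x z \<tau>_MN level[of x] level[of z] by auto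
        then have "(\<tau>, \<sigma>) \<in> tubing_digraph ?r {\<tau>, \<sigma>}" "(\<sigma>, \<tau>) \<in> tubing_digraph ?r {\<tau>, \<sigma>}"
          using x(1) z(1) 3 unfolding tubing_digraph_def \<tau>_def by blast+
        then have "(\<tau>, \<tau>) \<in> (tubing_digraph ?r {\<tau>, \<sigma>})\<^sup>+"
          by (meson trancl.intros)
        with acyc show False
          by (simp add: acyclic_def)
      qed
      moreover have "(1, 1) \<in> \<sigma>"
      proof -
        have "\<sigma> \<noteq> {}" using \<sigma>(2) by auto
        then obtain x where "x \<in> \<sigma>" by blast
        obtain z where "z \<in> \<sigma>" "(x, z) \<in> hasse_diagram ?r \<or> (z, x) \<in> hasse_diagram ?r"
          by (rule hasse_connected_neighbour[OF \<sigma>(4) \<open>x \<in> \<sigma>\<close> \<sigma>(2)])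
        then have xz: "x \<in> insert (1, 1) (M \<union> N)" "z \<in> insert (1, 1) (M \<union> N)"
            "fst x = Suc (fst z) \<or> fst z = Suc (fst x)"
          unfolding hasse by auto
        then have "x = (1, 1) \<or> z = (1, 1)"
          using \<open>x \<in> \<sigma>\<close> \<open>z \<in> \<sigma>\<close> \<open>\<sigma> \<inter> N = {}\<close> level[OF xz(1)] level[OF xz(2)] by auto
        with \<open>x \<in> \<sigma>\<close> \<open>z \<in> \<sigma>\<close> show ?thesis
          by auto
      qed
      moreover have "\<sigma> \<noteq> {(1, 1)}"
        using \<sigma>(2) by auto
      ultimately have "\<sigma> \<in> ?K3"
        using 3 \<sigma>(1) by (intro image_eqI[of _ _ "\<sigma> - {(1, 1)}"]) (auto simp: \<tau>_def)
      then show ?thesis by blast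
    qed
  }
  then show "?L \<subseteq> ?K1 \<union> ?K2 \<union> ?K3"
    by (rule subsetI)
  have \<tau>_nonempty: "\<tau> \<noteq> {}"
    by (simp add: \<tau>_def)
  have nested: "\<sigma> \<in> ?L" if "proper_tube ?r \<sigma>" "\<tau> \<subset> \<sigma>" for \<sigma>
  proof -
    have "tubing_digraph ?r {\<tau>, \<sigma>} = {}"
      using \<tau>_nonempty that(2) by (auto simp: tubing_digraph_def)
    then have "acyclic (tubing_digraph ?r {\<tau>, \<sigma>})"
      by (simp add: acyclic_def)
    with that tube_\<tau> show ?thesis
      by (auto simp: proper_tubing_def)
  qed
  show "?K1 \<union> ?K2 \<union> ?K3 \<subseteq> ?L"
  proof (intro Un_least)
    show "?K1 \<subseteq> ?L"
    proof
      fix \<sigma> assume "\<sigma> \<in> ?K1"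
      then obtain X where X: "X \<subseteq> M \<union> N - \<tau>" "X \<noteq> {}" "\<sigma> = \<tau> \<union> X" by blast
      then have "(1, 1) \<notin> \<sigma>" "\<sigma> \<subseteq> M \<union> N" "\<tau> \<subset> \<sigma>"
        using \<tau>_MN by auto
      then have "\<sigma> \<subset> insert (1, 1) (M \<union> N)" "\<tau> \<subseteq> \<sigma>" "\<tau> \<subset> \<sigma>" "(1, 1) \<in> \<sigma> \<Longrightarrow> M \<subseteq> \<sigma>"
        by auto
      then show "\<sigma> \<in> ?L"
        by (intro nested upper)
    qed
    show "?K2 \<subseteq> ?L"
    proof
      fix \<sigma> assume "\<sigma> \<in> ?K2"
      then obtain X where X: "X \<subset> N - {(3, 1)}" "\<sigma> = insert (1, 1) (M \<union> {(3, 1)}) \<union> X" by blast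
      then obtain z where "z \<in> N" "z \<noteq> (3, 1)" "z \<notin> X" by blast
      then have "z \<notin> \<sigma>"
        using X \<tau>_MN by auto
      then have "\<sigma> \<subset> insert (1, 1) (M \<union> N)"
        using X \<tau>_MN \<open>z \<in> N\<close> by auto
      moreover have "\<tau> \<subseteq> \<sigma>" "(1, 1) \<in> \<sigma>" "M \<subseteq> \<sigma>"
        using X(2) \<tau>_MN(1) unfolding \<tau>_def by blast+
      moreover have "\<tau> \<subset> \<sigma>"
        using \<open>\<tau> \<subseteq> \<sigma>\<close> \<open>(1, 1) \<in> \<sigma>\<close> \<tau>_MN(3,4) by blast
      ultimately show "\<sigma> \<in> ?L"
        by (intro nested upper)
    qed
    show "?K3 \<subseteq> ?L"
    proof
      fix \<sigma> assume "\<sigma> \<in> ?K3"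
      then obtain X where X: "X \<subseteq> M - {(2, 1)}" "X \<noteq> {}" "\<sigma> = insert (1, 1) X" by auto
      then have tube: "proper_tube ?r \<sigma>"
        using proper_tube_1mn_lower[OF assms(1,2), of X] by (auto simp: M_def)
      have disj: "\<sigma> \<inter> \<tau> = {}"
        using X \<tau>_MN by (auto simp: \<tau>_def)
      have "\<not> strictly_below ?r x y" if "x \<in> \<tau>" "y \<in> \<sigma>" for x y
      proof -
        have "fst x \<ge> 2"
          using that(1) by (auto simp: \<tau>_def)
        moreover have "y = (1, 1) \<or> y \<in> M"
          using that(2) X by blast
        then have "fst y \<le> 2"
          by (auto simp: M_def)
        ultimately show ?thesis
          unfolding below by linarith
      qed
      then have "tubing_digraph ?r {\<tau>, \<sigma>} \<subseteq> {(\<sigma>, \<tau>)}"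
        using \<tau>_nonempty X(3) by (auto simp: tubing_digraph_def)
      moreover have "\<sigma> \<noteq> \<tau>"
        using disj X(3) by auto
      then have "acyclic {(\<sigma>, \<tau>)}"
        by (simp add: acyclic_insert wf_acyclic)
      ultimately have "acyclic (tubing_digraph ?r {\<tau>, \<sigma>})"
        by (rule acyclic_subset[rotated])
      with tube tube_\<tau> disj \<open>\<sigma> \<noteq> \<tau>\<close> show "\<sigma> \<in> ?L"
        by (auto simp: proper_tubing_def)
    qed
  qed
qed

text \<open>
  With at least two elements on the middle and on the top level, each of the three families is a power
  set of a nonempty set with one member removed.
\<close>

lemma odd_tubing_degree_1mn:
  assumes "m \<ge> 2" "n \<ge> 2"
  shows "odd (card {\<sigma>. \<sigma> \<noteq> {(2, 1), (3, 1)} \<and>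
    proper_tubing (complete_graded_poset [1, m, n]) {{(2, 1), (3, 1)}, \<sigma>}})"
proof -
  define \<tau> :: "(nat \<times> nat) set" where "\<tau> = {(2, 1), (3, 1)}"
  define M :: "(nat \<times> nat) set" where "M = {2} \<times> {1..m}"
  define N :: "(nat \<times> nat) set" where "N = {3} \<times> {1..n}"
  let ?K1 = "(\<union>) \<tau> ` (Pow (M \<union> N - \<tau>) - {{}})"
  let ?K2 = "(\<union>) (insert (1, 1) (M \<union> {(3, 1)})) ` (Pow (N - {(3, 1)}) - {N - {(3, 1)}})"
  let ?K3 = "(\<union>) {(1, 1)} ` (Pow (M - {(2, 1)}) - {{}})"
  have fin: "finite M" "finite N"
    by (simp_all add: M_def N_def)
  have bot: "(1, 1) \<notin> M" "(1, 1) \<notin> N" "(1, 1) \<notin> \<tau>" "M \<inter> N = {}"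
    by (auto simp: M_def N_def \<tau>_def)
  have two: "(2, 2) \<in> M - {(2, 1)}" "(3, 2) \<in> N - {(3, 1)}" "(2, 2) \<in> M \<union> N - \<tau>"
    using assms by (auto simp: M_def N_def \<tau>_def)
  have K1: "odd (card ?K1)"
    using fin two(3) by (intro odd_card_image_Un) blast+
  have K2: "odd (card ?K2)"
    using fin two(2) bot by (intro odd_card_image_Un) blast+
  have K3: "odd (card ?K3)"
    using fin two(1) bot by (intro odd_card_image_Un) blast+
  have fins: "finite ?K1" "finite ?K2" "finite ?K3"
    using fin by simp_all
  have one: "(2, 1) \<in> \<tau>" "(2, 1) \<in> M"
    using assms by (auto simp: \<tau>_def M_def)
  have "(1, 1) \<notin> \<sigma> \<and> (2, 1) \<in> \<sigma>" if "\<sigma> \<in> ?K1" for \<sigma>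
    using that bot one by blast
  moreover have "(1, 1) \<in> \<sigma> \<and> (2, 1) \<in> \<sigma>" if "\<sigma> \<in> ?K2" for \<sigma>
    using that one by blast
  moreover have "(2, 1) \<notin> \<sigma>" if "\<sigma> \<in> ?K3" for \<sigma>
  proof -
    obtain X where "X \<subseteq> M - {(2, 1)}" "\<sigma> = {(1, 1)} \<union> X"
      using \<open>\<sigma> \<in> ?K3\<close> by blast
    then show ?thesis by auto
  qed
  ultimately have "?K1 \<inter> ?K2 = {}" "(?K1 \<union> ?K2) \<inter> ?K3 = {}"
    by blast+
  then have "card (?K1 \<union> ?K2 \<union> ?K3) = card ?K1 + card ?K2 + card ?K3"
    using fins by (simp only: card_Un_disjoint finite_UnI)
  then have "odd (card (?K1 \<union> ?K2 \<union> ?K3))"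
    using K1 K2 K3 by (simp only: even_add) simp
  then show ?thesis
    using assms tubing_degree_1mn[of m n] unfolding \<tau>_def M_def N_def by simp
qed

lemma proper_tubing_singleton_1mn:
  assumes "m \<ge> 1" "n \<ge> 1"
  shows "proper_tubing (complete_graded_poset [1, m, n]) {{(2, 1), (3, 1)}}"
proof -
  have "(1, 1) \<in> complete_graded_elements [1, m, n]"
      "{(2, 1), (3, 1)} \<subseteq> complete_graded_elements [1, m, n]"
    using assms unfolding complete_graded_elements_1mn by simp_all
  moreover have "(1, 1) \<notin> {(2, 1), (3, 1) :: nat \<times> nat}"
    by simp
  ultimately have "{(2, 1), (3, 1)} \<subset> complete_graded_elements [1, m, n]"
    by blast
  then have "proper_tube (complete_graded_poset [1, m, n]) {(2, 1), (3, 1)}"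
    by (rule proper_tube_1mn_upper[OF assms]) simp_all
  moreover have "tubing_digraph (complete_graded_poset [1, m, n]) {{(2, 1), (3, 1)}} = {}"
    by (auto simp: tubing_digraph_def)
  ultimately show ?thesis
    by (simp add: proper_tubing_def acyclic_def)
qed

section \<open>Comparison with the permutohedron\<close>

theorem theorem1p4:
  fixes m n :: nat
  assumes "m \<ge> 2" and "n \<ge> 2"
    and "CARD('n::finite) = m + n"
  shows "(\<forall>Q :: 'a::euclidean_space set.
            is_poset_associahedron (complete_graded_poset [m, 1, n]) Q \<longrightarrow>
            combinatorially_equivalent Q (permutohedron :: (real ^ 'n) set)) \<and>
         (\<forall>Q :: 'a set.
            is_poset_associahedron (complete_graded_poset [1, m, n]) Q \<longrightarrow>
            \<not> combinatorially_equivalent Q (permutohedron :: (real ^ 'n) set))"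
proof (intro conjI allI impI notI)
  fix Q :: "'a set"
  assume "is_poset_associahedron (complete_graded_poset [m, 1, n]) Q"
  then have "order_isomorphic_on {F. F face_of Q \<and> F \<noteq> {}} (\<subseteq>)
      {T. proper_tubing (complete_graded_poset [m, 1, n]) T} (\<supseteq>)"
    by (simp only: is_poset_associahedron_def)
  moreover have "order_isomorphic_on {T. proper_tubing (complete_graded_poset [m, 1, n]) T} (\<supseteq>)
      (proper_subset_chains :: 'n set set set) (\<supseteq>)"
    using assms by (intro tubings_m1n_isomorphic_chains) simp_all
  ultimately have iso: "order_isomorphic_on {F. F face_of Q \<and> F \<noteq> {}} (\<subseteq>)
      (proper_subset_chains :: 'n set set set) (\<supseteq>)"
    by (rule order_isomorphic_on_trans)
  show "combinatorially_equivalent Q (permutohedron :: (real ^ 'n) set)"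
    unfolding combinatorially_equivalent_iff_nonempty_faces
    using iso permutohedron_faces_isomorphic_chains by (rule order_isomorphic_on_trans)
next
  fix Q :: "'a set"
  let ?r = "complete_graded_poset [1, m, n]"
  let ?v = "{(2, 1), (3, 1)} :: (nat \<times> nat) set"
  assume "is_poset_associahedron ?r Q"
  then have "order_isomorphic_on {F. F face_of Q \<and> F \<noteq> {}} (\<subseteq>) {T. proper_tubing ?r T} (\<supseteq>)"
    by (simp only: is_poset_associahedron_def)
  then have tubings: "order_isomorphic_on {T. proper_tubing ?r T} (\<supseteq>) {F. F face_of Q \<and> F \<noteq> {}} (\<subseteq>)"
    by (rule order_isomorphic_on_sym)
  assume "combinatorially_equivalent Q (permutohedron :: (real ^ 'n) set)"
  then have "order_isomorphic_on {F. F face_of Q \<and> F \<noteq> {}} (\<subseteq>)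
      {F. F face_of (permutohedron :: (real ^ 'n) set) \<and> F \<noteq> {}} (\<subseteq>)"
    by (simp only: combinatorially_equivalent_iff_nonempty_faces)
  then have "order_isomorphic_on {F. F face_of Q \<and> F \<noteq> {}} (\<subseteq>) (proper_subset_chains :: 'n set set set) (\<supseteq>)"
    by (rule order_isomorphic_on_trans[OF _ order_isomorphic_on_sym[OF permutohedron_faces_isomorphic_chains]])
  with tubings have iso: "order_isomorphic_on {T. proper_tubing ?r T} (\<supseteq>) (proper_subset_chains :: 'n set set set) (\<supseteq>)"
    by (rule order_isomorphic_on_trans)
  have fin: "finite (Field ?r)"
    unfolding Field_complete_graded_poset by (rule finite_complete_graded_elements)
  have mn: "m \<ge> 1" "n \<ge> 1"
    using assms by simp_all
  obtain w :: "'n set" where w: "{w} \<in> proper_subset_chains"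
    and degree: "card {u. u \<noteq> w \<and> {w, u} \<in> proper_subset_chains} =
      card {u. u \<noteq> ?v \<and> {?v, u} \<in> {T. proper_tubing ?r T}}"
  proof (rule order_isomorphic_vertex_degree[OF iso])
    show "T \<in> {T. proper_tubing ?r T}" if "S \<in> {T. proper_tubing ?r T}" "T \<subseteq> S" for S T
      using that proper_tubing_subset[of ?r S T] by simp
    show "finite S" if "S \<in> {T. proper_tubing ?r T}" for S
      using that proper_tubing_finite[OF _ fin, of S] by simp
    show "T \<in> proper_subset_chains" if "S \<in> proper_subset_chains" "T \<subseteq> S" for S T :: "'n set set"
      using that by (rule proper_subset_chains_subset)
    show "finite S" if "S \<in> proper_subset_chains" for S :: "'n set set"
      by simp
    show "{?v} \<in> {T. proper_tubing ?r T}"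
      unfolding mem_Collect_eq by (rule proper_tubing_singleton_1mn[OF mn])
  qed
  from even_card_chain_degree[OF w] odd_tubing_degree_1mn[OF assms(1,2)]
  show False
    unfolding degree mem_Collect_eq by contradiction
qed

end
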